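(* The category whose objects are the posets $\langle L\otimes U,\leq_p\rangle$ for approximation tuples $(L,U,\leq)$ and whose morphisms are the monotone functions between them is a Cartesian closed full subcategory of the category of chain-complete posets with monotone functions.
   Context: An approximation tuple is a tuple $(L,U,\leq)$ where $L,U$ are sets and $\leq$ is a partial order on $L\cup U$ such that: $\langle L\cup U,\leq\rangle$ has a top element $\top$ and bottom element $\bot$; $\top,\bot\in L\cap U$; $\langle L,\leq\rangle$ and $\langle U,\leq\rangle$ are complete lattices; (ILP) for all $b\in U$ and all $S\subseteq L$ with $x\leq b$ for every $x\in S$, the least upper bound of $S$ in $L$ is $\leq b$; (IGP) for all $a\in L$ and all $S\subseteq U$ with $a\leq x$ for every $x\in S$, $a$ is $\leq$ the greatest lower bound of $S$ in $U$. The associated approximation space is $L\otimes U=\{(x,y)\mid x\in L, y\in U, x\leq y\}$ with the precision order $(x_1,y_1)\leq_p(x_2,y_2)$ iff $x_1\leq x_2$ and $y_2\leq y_1$. A category is Cartesian closed if it has a terminal object, binary products and exponentials. *)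

theory Defs
  imports "HOL-Algebra.Complete_Lattice" "HOL-Library.Equipollence"
begin

section \<open>Categories\<close>

text \<open>Hom-sets are indexed by their two objects and need not be disjoint, so composition takes the
  objects as arguments: \<open>Cmp C X Y Z g f\<close> is the composite of \<open>f : X \<rightarrow> Y\<close> and \<open>g : Y \<rightarrow> Z\<close>.\<close>

record ('o, 'm) category_data =
  Ob :: "'o set"
  Hom :: "'o \<Rightarrow> 'o \<Rightarrow> 'm set"
  Id :: "'o \<Rightarrow> 'm"
  Cmp :: "'o \<Rightarrow> 'o \<Rightarrow> 'o \<Rightarrow> 'm \<Rightarrow> 'm \<Rightarrow> 'm"

locale category =
  fixes C :: "('o, 'm) category_data"
  assumes Id_in_Hom: "X \<in> Ob C \<Longrightarrow> Id C X \<in> Hom C X X"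
    and Cmp_in_Hom: "\<lbrakk>X \<in> Ob C; Y \<in> Ob C; Z \<in> Ob C; f \<in> Hom C X Y; g \<in> Hom C Y Z\<rbrakk>
      \<Longrightarrow> Cmp C X Y Z g f \<in> Hom C X Z"
    and Cmp_Id_left: "\<lbrakk>X \<in> Ob C; Y \<in> Ob C; f \<in> Hom C X Y\<rbrakk> \<Longrightarrow> Cmp C X Y Y (Id C Y) f = f"
    and Cmp_Id_right: "\<lbrakk>X \<in> Ob C; Y \<in> Ob C; f \<in> Hom C X Y\<rbrakk> \<Longrightarrow> Cmp C X X Y f (Id C X) = f"
    and Cmp_assoc: "\<lbrakk>W \<in> Ob C; X \<in> Ob C; Y \<in> Ob C; Z \<in> Ob C;
        f \<in> Hom C W X; g \<in> Hom C X Y; h \<in> Hom C Y Z\<rbrakk>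
      \<Longrightarrow> Cmp C W Y Z h (Cmp C W X Y g f) = Cmp C W X Z (Cmp C X Y Z h g) f"

definition subcategory :: "('o, 'm) category_data \<Rightarrow> ('o, 'm) category_data \<Rightarrow> bool" where
  "subcategory D C \<longleftrightarrow> category D \<and> category C \<and> Ob D \<subseteq> Ob C \<and>
     (\<forall>X\<in>Ob D. \<forall>Y\<in>Ob D. Hom D X Y \<subseteq> Hom C X Y) \<and>
     (\<forall>X\<in>Ob D. Id D X = Id C X) \<and>
     (\<forall>X\<in>Ob D. \<forall>Y\<in>Ob D. \<forall>Z\<in>Ob D. \<forall>f\<in>Hom D X Y. \<forall>g\<in>Hom D Y Z.
        Cmp D X Y Z g f = Cmp C X Y Z g f)"

definition full_subcategory :: "('o, 'm) category_data \<Rightarrow> ('o, 'm) category_data \<Rightarrow> bool" where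
  "full_subcategory D C \<longleftrightarrow>
     subcategory D C \<and> (\<forall>X\<in>Ob D. \<forall>Y\<in>Ob D. Hom D X Y = Hom C X Y)"

definition is_terminal :: "('o, 'm) category_data \<Rightarrow> 'o \<Rightarrow> bool" where
  "is_terminal C T \<longleftrightarrow> T \<in> Ob C \<and> (\<forall>X\<in>Ob C. \<exists>!f. f \<in> Hom C X T)"

definition is_product ::
  "('o, 'm) category_data \<Rightarrow> 'o \<Rightarrow> 'o \<Rightarrow> 'o \<Rightarrow> 'm \<Rightarrow> 'm \<Rightarrow> bool" where
  "is_product C A B P p q \<longleftrightarrow>
     P \<in> Ob C \<and> p \<in> Hom C P A \<and> q \<in> Hom C P B \<and>
     (\<forall>X\<in>Ob C. \<forall>f\<in>Hom C X A. \<forall>g\<in>Hom C X B.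
        \<exists>!h. h \<in> Hom C X P \<and> Cmp C X P A p h = f \<and> Cmp C X P B q h = g)"

text \<open>\<open>E\<close> is an exponential of \<open>B\<close> by \<open>A\<close>, with evaluation \<open>ev\<close> out of a product \<open>(P, p, q)\<close> of
  \<open>E\<close> and \<open>A\<close>. In the universal property \<open>k\<close> is the arrow \<open>h \<times> id\<close> from a product \<open>Q\<close> of \<open>X\<close> and
  \<open>A\<close> to \<open>P\<close>.\<close>

definition is_exponential ::
  "('o, 'm) category_data \<Rightarrow> 'o \<Rightarrow> 'o \<Rightarrow> 'o \<Rightarrow> 'o \<Rightarrow> 'm \<Rightarrow> 'm \<Rightarrow> 'm \<Rightarrow> bool" where
  "is_exponential C A B E P p q ev \<longleftrightarrow>
     E \<in> Ob C \<and> is_product C E A P p q \<and> ev \<in> Hom C P B \<and>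
     (\<forall>X\<in>Ob C. \<forall>Q p' q'. is_product C X A Q p' q' \<longrightarrow>
        (\<forall>g\<in>Hom C Q B. \<exists>!h. h \<in> Hom C X E \<and>
           (\<exists>k\<in>Hom C Q P. Cmp C Q P E p k = Cmp C Q X E h p' \<and> Cmp C Q P A q k = q' \<and>
              Cmp C Q P B ev k = g)))"

definition has_terminal :: "('o, 'm) category_data \<Rightarrow> bool" where
  "has_terminal C \<longleftrightarrow> (\<exists>T. is_terminal C T)"

definition has_binary_products :: "('o, 'm) category_data \<Rightarrow> bool" where
  "has_binary_products C \<longleftrightarrow> (\<forall>A\<in>Ob C. \<forall>B\<in>Ob C. \<exists>P p q. is_product C A B P p q)"

definition has_exponential :: "('o, 'm) category_data \<Rightarrow> 'o \<Rightarrow> 'o \<Rightarrow> bool" where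
  "has_exponential C A B \<longleftrightarrow> (\<exists>E P p q ev. is_exponential C A B E P p q ev)"

definition cartesian_closed :: "('o, 'm) category_data \<Rightarrow> bool" where
  "cartesian_closed C \<longleftrightarrow> category C \<and> has_terminal C \<and> has_binary_products C \<and>
     (\<forall>A\<in>Ob C. \<forall>B\<in>Ob C. has_exponential C A B)"


section \<open>Sizes\<close>

text \<open>No type contains all sets, so categories of all posets are rendered relative to a
  predicate \<open>small\<close> on the subsets of an arbitrary type \<open>'u\<close>. A set of any type is regarded as small
  if it injects into a small subset of \<open>'u\<close>. A universe is in addition closed under function
  spaces, as a Grothendieck universe is; its other closure properties are not needed. HOL does not prove that
  a universe with an infinite member exists; \<open>smallness\<close> omits the closure under function spaces, and
  an exponential can then be asked for where the hom-set in question is itself small.\<close>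

definition fits :: "('u set \<Rightarrow> bool) \<Rightarrow> 'a set \<Rightarrow> bool" where
  "fits small A \<longleftrightarrow> (\<exists>V. small V \<and> A \<lesssim> V)"

locale smallness =
  fixes small :: "'u set \<Rightarrow> bool"
  assumes nonempty: "\<exists>S. small S \<and> S \<noteq> {}"
    and lepoll_closed: "\<lbrakk>small S; T \<lesssim> S\<rbrakk> \<Longrightarrow> small T"
    and times_closed: "\<lbrakk>small S; small T\<rbrakk> \<Longrightarrow> fits small (S \<times> T)"

locale universe = smallness +
  assumes funcset_closed: "\<lbrakk>small S; small T\<rbrakk> \<Longrightarrow> fits small (S \<rightarrow>\<^sub>E T)"


text \<open>Two instances: all subsets of an infinite type, and the finite sets.\<close>

lemma smallness_all:
  assumes "infinite (UNIV :: 'u set)"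
  shows "smallness (\<lambda>_ :: 'u set. True)"
proof
  fix S T :: "'u set"
  have "S \<times> T \<lesssim> (UNIV :: 'u set) \<times> (UNIV :: 'u set)"
    by (simp add: subset_imp_lepoll)
  also have "\<dots> \<approx> (UNIV :: 'u set)"
    using card_of_Times_same_infinite[OF assms] eqpoll_iff_card_of_ordIso by blast
  finally show "fits (\<lambda>_ :: 'u set. True) (S \<times> T)"
    unfolding fits_def by blast
qed auto

lemma fits_finite:
  assumes "infinite (UNIV :: 'u set)" "finite A"
  shows "fits (finite :: 'u set \<Rightarrow> bool) A"
proof -
  obtain V :: "'u set" where "finite V" "card V = card A"
    using infinite_arbitrarily_large[OF assms(1)] by blast
  then show ?thesis
    unfolding fits_def using assms(2) lepoll_iff_card_le[of A V] by auto
qed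

lemma universe_finite:
  assumes inf: "infinite (UNIV :: 'u set)"
  shows "universe (finite :: 'u set \<Rightarrow> bool)"
proof
  show "\<exists>S :: 'u set. finite S \<and> S \<noteq> {}"
    by (rule exI[of _ "{undefined}"]) simp
next
  fix S T :: "'u set" assume "finite S" "T \<lesssim> S"
  then show "finite T"
    by (meson finite_surj lepoll_iff)
qed (auto intro: fits_finite[OF inf] finite_PiE)


section \<open>Chain-complete posets\<close>

definition poset_on :: "'a set \<Rightarrow> ('a \<Rightarrow> 'a \<Rightarrow> bool) \<Rightarrow> 'a gorder" where
  "poset_on A r = \<lparr>carrier = A, eq = (=), le = r\<rparr>"

text \<open>The empty set is a chain, so a chain-complete poset has a bottom element.\<close>

definition chain_complete :: "'a gorder \<Rightarrow> bool" where
  "chain_complete P \<longleftrightarrow> partial_order P \<and>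
     (\<forall>S\<subseteq>carrier P. (\<forall>x\<in>S. \<forall>y\<in>S. x \<sqsubseteq>\<^bsub>P\<^esub> y \<or> y \<sqsubseteq>\<^bsub>P\<^esub> x) \<longrightarrow> (\<exists>s. is_lub P s S))"

text \<open>Arrows are extensional functions, so that two arrows are equal iff they agree on the carrier
  of the domain.\<close>

definition monotone_category :: "'a gorder set \<Rightarrow> ('a gorder, 'a \<Rightarrow> 'a) category_data" where
  "monotone_category K =
     \<lparr>Ob = K,
      Hom = (\<lambda>P Q. {f \<in> carrier P \<rightarrow>\<^sub>E carrier Q. isotone P Q f}),
      Id = (\<lambda>P. \<lambda>x\<in>carrier P. x),
      Cmp = (\<lambda>P Q R g f. compose (carrier P) g f)\<rparr>"

definition cpo_category :: "('u set \<Rightarrow> bool) \<Rightarrow> ('a gorder, 'a \<Rightarrow> 'a) category_data" where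
  "cpo_category small = monotone_category {P. chain_complete P \<and> fits small (carrier P)}"


section \<open>Approximation spaces\<close>

locale approximation_tuple =
  fixes L U :: "'u set" and r :: "'u \<Rightarrow> 'u \<Rightarrow> bool"
  assumes order: "partial_order (poset_on (L \<union> U) r)"
    and top: "\<exists>t\<in>L \<inter> U. greatest (poset_on (L \<union> U) r) t (L \<union> U)"
    and bottom: "\<exists>b\<in>L \<inter> U. least (poset_on (L \<union> U) r) b (L \<union> U)"
    and complete_L: "complete_lattice (poset_on L r)"
    and complete_U: "complete_lattice (poset_on U r)"
    and ILP: "\<lbrakk>b \<in> U; S \<subseteq> L; \<forall>x\<in>S. r x b\<rbrakk> \<Longrightarrow> r (\<Squnion>\<^bsub>poset_on L r\<^esub> S) b"
    and IGP: "\<lbrakk>a \<in> L; S \<subseteq> U; \<forall>x\<in>S. r a x\<rbrakk> \<Longrightarrow> r a (\<Sqinter>\<^bsub>poset_on U r\<^esub> S)"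

definition approximation_space ::
  "'u set \<Rightarrow> 'u set \<Rightarrow> ('u \<Rightarrow> 'u \<Rightarrow> bool) \<Rightarrow> ('u \<times> 'u) gorder" where
  "approximation_space L U r =
     poset_on {(x, y). x \<in> L \<and> y \<in> U \<and> r x y} (\<lambda>(x1, y1) (x2, y2). r x1 x2 \<and> r y2 y1)"

definition approximation_category ::
  "('u set \<Rightarrow> bool) \<Rightarrow> (('u \<times> 'u) gorder, 'u \<times> 'u \<Rightarrow> 'u \<times> 'u) category_data" where
  "approximation_category small = monotone_category
     {approximation_space L U r | L U r. approximation_tuple L U r \<and> small (L \<union> U)}"

end

theory Submission
  imports Defs
begin

text \<open>An approximation tuple amounts to a poset \<open>L \<union> U\<close> with top and bottom in \<open>L \<inter> U\<close> in which every
  subset of \<open>L\<close> has a least upper bound that lies in \<open>L\<close>, and every subset of \<open>U\<close> a greatest lower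
  bound that lies in \<open>U\<close>. In this form the notion is self-dual and passes to pointwise orders. Products
  are \<open>(L1 \<otimes> U1) \<times> (L2 \<otimes> U2) \<cong> (L1 \<times> L2) \<otimes> (U1 \<times> U2)\<close>, and the exponential of \<open>L \<otimes> U\<close> by \<open>P\<close> is the
  approximation space of the monotone maps \<open>P \<rightarrow> L\<close> and the antitone maps \<open>P \<rightarrow> U\<close>, ordered pointwise.
  A tuple over any type whose underlying set is of small size is copied to \<open>'u\<close> along an injection.\<close>

section \<open>Approximation tuples in elementary terms\<close>

lemma poset_on_simps [simp]:
  "carrier (poset_on A r) = A" "eq (poset_on A r) = (=)" "le (poset_on A r) = r"
  by (simp_all add: poset_on_def)

lemma partial_order_poset_on_iff:
  "partial_order (poset_on A r) \<longleftrightarrow> reflp_on A r \<and> antisymp_on A r \<and> transp_on A r"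
proof
  assume "partial_order (poset_on A r)"
  then interpret partial_order "poset_on A r" .
  show "reflp_on A r \<and> antisymp_on A r \<and> transp_on A r"
    by (intro conjI reflp_onI antisymp_onI transp_onI)
      (use le_refl le_antisym le_trans in \<open>simp; blast\<close>)+
next
  assume *: "reflp_on A r \<and> antisymp_on A r \<and> transp_on A r"
  show "partial_order (poset_on A r)"
    by unfold_locales
      (use * in \<open>auto dest: reflp_onD antisymp_onD transp_onD\<close>)
qed

section \<open>Order duality\<close>

lemma poset_on_dual:
  shows "least (poset_on A r\<inverse>\<inverse>) = greatest (poset_on A r)"
    and "greatest (poset_on A r\<inverse>\<inverse>) = least (poset_on A r)"
    and "Upper (poset_on A r\<inverse>\<inverse>) = Lower (poset_on A r)"
    and "Lower (poset_on A r\<inverse>\<inverse>) = Upper (poset_on A r)"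
    and "\<Squnion>\<^bsub>poset_on A r\<inverse>\<inverse>\<^esub> S = \<Sqinter>\<^bsub>poset_on A r\<^esub> S"
    and "\<Sqinter>\<^bsub>poset_on A r\<inverse>\<inverse>\<^esub> S = \<Squnion>\<^bsub>poset_on A r\<^esub> S"
proof -
  show lg: "least (poset_on A r\<inverse>\<inverse>) = greatest (poset_on A r)"
    "greatest (poset_on A r\<inverse>\<inverse>) = least (poset_on A r)"
    by (simp_all add: fun_eq_iff least_def greatest_def)
  show UL: "Upper (poset_on A r\<inverse>\<inverse>) = Lower (poset_on A r)"
    "Lower (poset_on A r\<inverse>\<inverse>) = Upper (poset_on A r)"
    by (simp_all add: fun_eq_iff Upper_def Lower_def)
  show "\<Squnion>\<^bsub>poset_on A r\<inverse>\<inverse>\<^esub> S = \<Sqinter>\<^bsub>poset_on A r\<^esub> S"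
    "\<Sqinter>\<^bsub>poset_on A r\<inverse>\<inverse>\<^esub> S = \<Squnion>\<^bsub>poset_on A r\<^esub> S"
    by (simp_all add: Lattice.sup_def Lattice.inf_def lg UL)
qed

lemma partial_order_poset_on_dual:
  "partial_order (poset_on A r\<inverse>\<inverse>) \<longleftrightarrow> partial_order (poset_on A r)"
  by (simp add: partial_order_poset_on_iff)

lemma complete_lattice_poset_on_dual:
  "complete_lattice (poset_on A r\<inverse>\<inverse>) \<longleftrightarrow> complete_lattice (poset_on A r)"
  by (auto simp: complete_lattice_def complete_lattice_axioms_def
      partial_order_poset_on_dual poset_on_dual)

text \<open>Reversing the order exchanges top with bottom, suprema with infima and hence ILP with
  IGP, once \<open>L\<close> and \<open>U\<close> trade places. Through this, facts about
  \<open>U\<close> and infima come from those about \<open>L\<close> and suprema.\<close>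

lemma approximation_tuple_dual:
  assumes "approximation_tuple L U r"
  shows "approximation_tuple U L r\<inverse>\<inverse>"
proof -
  interpret approximation_tuple L U r by fact
  show ?thesis
    by (rule approximation_tuple.intro)
      (simp_all only: Un_commute[of U] Int_commute[of U] partial_order_poset_on_dual
        complete_lattice_poset_on_dual poset_on_dual conversep_iff order top bottom
        complete_L complete_U ILP IGP)
qed

section \<open>Least upper bounds in \<open>L\<close> tested against bounds in
  \<open>L \<union> U\<close>\<close>

lemma is_lub_poset_on_iff:
  assumes "S \<subseteq> A"
  shows "is_lub (poset_on A r) s S \<longleftrightarrow>
    s \<in> A \<and> (\<forall>x\<in>S. r x s) \<and> (\<forall>b\<in>A. (\<forall>x\<in>S. r x b) \<longrightarrow> r s b)"
  using assms by (auto simp: least_def Upper_def subset_iff)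

text \<open>\<open>Lattice.sup\<close> chooses some least upper bound, and antisymmetry leaves only
  one to choose.\<close>

lemma sup_poset_on_eq:
  assumes "partial_order (poset_on A r)" "is_lub (poset_on A r) s S"
  shows "\<Squnion>\<^bsub>poset_on A r\<^esub> S = s"
  unfolding Lattice.sup_def
  by (rule some_equality[where P = "\<lambda>x. is_lub (poset_on A r) x S"])
    (fact assms(2), rule partial_order.least_unique[OF assms(1) _ assms(2)])

text \<open>With \<open>M = L\<close> this is the existence of all suprema in \<open>L\<close>; with
  \<open>M = L \<union> U\<close> it contains ILP as well. For \<open>U\<close> and
  \<open>r\<inverse>\<inverse>\<close> it is the existence of infima in \<open>U\<close> together
  with IGP.\<close>

definition lub_closed :: "'a set \<Rightarrow> 'a set \<Rightarrow> ('a \<Rightarrow> 'a \<Rightarrow> bool) \<Rightarrow> bool" where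
  "lub_closed L M r \<longleftrightarrow>
     (\<forall>S\<subseteq>L. \<exists>s\<in>L. (\<forall>x\<in>S. r x s) \<and> (\<forall>b\<in>M. (\<forall>x\<in>S. r x b) \<longrightarrow> r s b))"

lemma lub_closed_mono: "lub_closed L M r \<Longrightarrow> M' \<subseteq> M \<Longrightarrow> lub_closed L M' r"
  unfolding lub_closed_def by (meson subsetD)

text \<open>Suprema suffice: the infimum of \<open>S\<close> is the supremum of its set of lower
  bounds \<open>?B\<close>.\<close>

lemma complete_lattice_poset_onI:
  assumes po: "partial_order (poset_on A r)" and lubs: "lub_closed A A r"
  shows "complete_lattice (poset_on A r)"
proof -
  interpret partial_order "poset_on A r" by fact
  show ?thesis
  proof (rule complete_latticeI)
    fix S assume "S \<subseteq> carrier (poset_on A r)"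
    then have S: "S \<subseteq> A" by simp
    show "\<exists>s. is_lub (poset_on A r) s S"
      using lubs S unfolding lub_closed_def is_lub_poset_on_iff[OF S] by blast
    let ?B = "{b\<in>A. \<forall>x\<in>S. r b x}"
    obtain s where "s \<in> A" "\<forall>b\<in>?B. r b s" "\<forall>b\<in>A. (\<forall>x\<in>?B. r x b) \<longrightarrow> r s b"
      using lubs[unfolded lub_closed_def, rule_format, of ?B] by blast
    then have "is_glb (poset_on A r) s S"
      using S by (auto simp: greatest_def Lower_def subset_iff)
    then show "\<exists>s. is_glb (poset_on A r) s S" ..
  qed
qed

text \<open>Upper bounds in \<open>L\<close> are handled by completeness of \<open>L\<close>, those
  in \<open>U\<close> by ILP.\<close>

lemma (in approximation_tuple) lub_closed_L: "lub_closed L (L \<union> U) r"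
  unfolding lub_closed_def
proof (intro allI impI)
  fix S assume S: "S \<subseteq> L"
  interpret L: complete_lattice "poset_on L r" by (rule complete_L)
  let ?s = "\<Squnion>\<^bsub>poset_on L r\<^esub> S"
  have "is_lub (poset_on L r) ?s S"
    using S L.sup_lub[of S] by simp
  then show "\<exists>s\<in>L. (\<forall>x\<in>S. r x s) \<and> (\<forall>b\<in>L \<union> U. (\<forall>x\<in>S. r x b) \<longrightarrow> r s b)"
    using ILP[OF _ S] unfolding is_lub_poset_on_iff[OF S] by blast
qed

lemma (in approximation_tuple) lub_closed_U: "lub_closed U (L \<union> U) r\<inverse>\<inverse>"
  using approximation_tuple.lub_closed_L[OF approximation_tuple_dual[OF approximation_tuple_axioms]]
  by (simp add: Un_commute)

text \<open>Converse of \<open>lub_closed_L\<close>: uniqueness of suprema identifies the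
  \<open>\<Squnion>\<close> of ILP with the bound that \<open>lub_closed\<close> provides.\<close>

lemma lub_closed_imp:
  assumes po: "partial_order (poset_on (L \<union> U) r)" and lubs: "lub_closed L (L \<union> U) r"
  shows "complete_lattice (poset_on L r)"
    and "b \<in> U \<Longrightarrow> S \<subseteq> L \<Longrightarrow> \<forall>x\<in>S. r x b \<Longrightarrow> r (\<Squnion>\<^bsub>poset_on L r\<^esub> S) b"
proof -
  have poL: "partial_order (poset_on L r)"
    using po reflp_on_subset[of "L \<union> U" r L] antisymp_on_subset[of "L \<union> U" r L]
      transp_on_subset[of "L \<union> U" r L]
    by (simp add: partial_order_poset_on_iff)
  then show "complete_lattice (poset_on L r)"
    using lubs by (intro complete_lattice_poset_onI) (auto elim: lub_closed_mono)
  assume S: "S \<subseteq> L" and b: "b \<in> U" "\<forall>x\<in>S. r x b"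
  obtain s where s: "s \<in> L" "\<forall>x\<in>S. r x s" "\<forall>b\<in>L \<union> U. (\<forall>x\<in>S. r x b) \<longrightarrow> r s b"
    using lubs S unfolding lub_closed_def by blast
  then have "\<Squnion>\<^bsub>poset_on L r\<^esub> S = s"
    by (intro sup_poset_on_eq poL) (simp add: is_lub_poset_on_iff[OF S])
  then show "r (\<Squnion>\<^bsub>poset_on L r\<^esub> S) b"
    using s b by simp
qed

lemma approximation_tupleI:
  assumes "reflp_on (L \<union> U) r" "antisymp_on (L \<union> U) r" "transp_on (L \<union> U) r"
    and "\<exists>t\<in>L \<inter> U. \<forall>x\<in>L \<union> U. r x t" "\<exists>b\<in>L \<inter> U. \<forall>x\<in>L \<union> U. r b x"
    and L: "lub_closed L (L \<union> U) r" and U: "lub_closed U (L \<union> U) r\<inverse>\<inverse>"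
  shows "approximation_tuple L U r"
proof -
  have po: "partial_order (poset_on (L \<union> U) r)"
    using assms(1-3) by (simp add: partial_order_poset_on_iff)
  then have po': "partial_order (poset_on (U \<union> L) r\<inverse>\<inverse>)"
    by (simp add: partial_order_poset_on_dual Un_commute)
  have U': "lub_closed U (U \<union> L) r\<inverse>\<inverse>"
    using U by (simp add: Un_commute)
  \<comment> \<open>Completeness of \<open>U\<close> and IGP are the two conclusions of
    \<open>lub_closed_imp\<close> read in the reversed order.\<close>
  note dual = lub_closed_imp[OF po' U', unfolded complete_lattice_poset_on_dual poset_on_dual conversep_iff]
  show ?thesis
  proof (rule approximation_tuple.intro)
    show "\<exists>t\<in>L \<inter> U. greatest (poset_on (L \<union> U) r) t (L \<union> U)"
      using assms(4) by (auto simp: greatest_def)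
    show "\<exists>b\<in>L \<inter> U. least (poset_on (L \<union> U) r) b (L \<union> U)"
      using assms(5) by (auto simp: least_def)
  qed (fact po lub_closed_imp[OF po L] dual)+
qed

lemma (in approximation_tuple) order_on:
  "reflp_on (L \<union> U) r" "antisymp_on (L \<union> U) r" "transp_on (L \<union> U) r"
  using order by (simp_all add: partial_order_poset_on_iff)

lemma (in approximation_tuple) top_elt: "\<exists>t\<in>L \<inter> U. \<forall>x\<in>L \<union> U. r x t"
  using top by (auto simp: greatest_def)

lemma (in approximation_tuple) bottom_elt: "\<exists>b\<in>L \<inter> U. \<forall>x\<in>L \<union> U. r b x"
  using bottom by (auto simp: least_def)

section \<open>Products, function spaces and images of approximation tuples\<close>

definition prod_le :: "('a \<Rightarrow> 'a \<Rightarrow> bool) \<Rightarrow> ('b \<Rightarrow> 'b \<Rightarrow> bool) \<Rightarrow> 'a \<times> 'b \<Rightarrow> 'a \<times> 'b \<Rightarrow> bool" where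
  "prod_le r s x y \<longleftrightarrow> r (fst x) (fst y) \<and> s (snd x) (snd y)"

definition fun_le :: "'a set \<Rightarrow> ('b \<Rightarrow> 'b \<Rightarrow> bool) \<Rightarrow> ('a \<Rightarrow> 'b) \<Rightarrow> ('a \<Rightarrow> 'b) \<Rightarrow> bool" where
  "fun_le X r f g \<longleftrightarrow> (\<forall>x\<in>X. r (f x) (g x))"

lemma prod_le_conversep: "(prod_le r s)\<inverse>\<inverse> = prod_le r\<inverse>\<inverse> s\<inverse>\<inverse>"
  by (simp add: fun_eq_iff prod_le_def)

lemma fun_le_conversep: "(fun_le X r)\<inverse>\<inverse> = fun_le X r\<inverse>\<inverse>"
  by (simp add: fun_eq_iff fun_le_def)

text \<open>Form for families, applied below to coordinates of pairs and to values of functions at a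
  point.\<close>

lemma lub_closed_image_lub:
  assumes "lub_closed L M r" "f ` S \<subseteq> L"
  obtains s where "s \<in> L" "\<forall>x\<in>S. r (f x) s" "\<forall>b\<in>M. (\<forall>x\<in>S. r (f x) b) \<longrightarrow> r s b"
  using assms(1)[unfolded lub_closed_def, rule_format, OF assms(2)] by auto

lemma lub_closedI:
  assumes "\<And>S. S \<subseteq> L \<Longrightarrow>
    \<exists>s\<in>L. (\<forall>x\<in>S. r x s) \<and> (\<forall>b\<in>M. (\<forall>x\<in>S. r x b) \<longrightarrow> r s b)"
  shows "lub_closed L M r"
  using assms by (simp add: lub_closed_def)

lemma lub_closed_times:
  assumes 1: "lub_closed L1 M1 r1" and 2: "lub_closed L2 M2 r2"
  shows "lub_closed (L1 \<times> L2) (M1 \<times> M2) (prod_le r1 r2)"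
proof (rule lub_closedI)
  fix S assume S: "S \<subseteq> L1 \<times> L2"
  from S have "fst ` S \<subseteq> L1" "snd ` S \<subseteq> L2" by auto
  obtain s where s: "s \<in> L1" "\<forall>x\<in>S. r1 (fst x) s" "\<forall>b\<in>M1. (\<forall>x\<in>S. r1 (fst x) b) \<longrightarrow> r1 s b"
    by (rule lub_closed_image_lub[OF 1 \<open>fst ` S \<subseteq> L1\<close>])
  obtain t where t: "t \<in> L2" "\<forall>x\<in>S. r2 (snd x) t" "\<forall>b\<in>M2. (\<forall>x\<in>S. r2 (snd x) b) \<longrightarrow> r2 t b"
    by (rule lub_closed_image_lub[OF 2 \<open>snd ` S \<subseteq> L2\<close>])
  show "\<exists>s\<in>L1 \<times> L2. (\<forall>x\<in>S. prod_le r1 r2 x s) \<and>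
      (\<forall>b\<in>M1 \<times> M2. (\<forall>x\<in>S. prod_le r1 r2 x b) \<longrightarrow> prod_le r1 r2 s b)"
  proof (intro bexI[of _ "(s, t)"] conjI ballI impI)
    fix b assume "b \<in> M1 \<times> M2" "\<forall>x\<in>S. prod_le r1 r2 x b"
    then show "prod_le r1 r2 (s, t) b"
      using s(3) t(3) by (auto simp: prod_le_def)
  qed (use s(1,2) t(1,2) in \<open>auto simp: prod_le_def\<close>)
qed

text \<open>Suprema are formed pointwise. The competitors in \<open>F\<close> only need values in
  \<open>M\<close>: for approximation tuples they include the antitone maps into \<open>U\<close>
  beside the monotone maps into \<open>L\<close>.\<close>

lemma lub_closed_funcset:
  assumes lubs: "lub_closed L M r" and "L \<subseteq> M" and trans: "transp_on M r" and F: "F \<subseteq> X \<rightarrow> M"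
  shows "lub_closed {f \<in> X \<rightarrow>\<^sub>E L. \<forall>a\<in>X. \<forall>b\<in>X. leX a b \<longrightarrow> r (f a) (f b)} F (fun_le X r)"
    (is "lub_closed ?L _ _")
proof (rule lub_closedI)
  fix S assume S: "S \<subseteq> ?L"
  have "\<exists>s\<in>L. (\<forall>f\<in>S. r (f x) s) \<and> (\<forall>b\<in>M. (\<forall>f\<in>S. r (f x) b) \<longrightarrow> r s b)" if "x \<in> X" for x
  proof -
    have "(\<lambda>f. f x) ` S \<subseteq> L" using S that by auto
    from lub_closed_image_lub[OF lubs this] show ?thesis by metis
  qed
  then obtain s where s: "s x \<in> L" "\<forall>f\<in>S. r (f x) (s x)"
      "\<forall>b\<in>M. (\<forall>f\<in>S. r (f x) b) \<longrightarrow> r (s x) b" if "x \<in> X" for x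
    by metis
  \<comment> \<open>For \<open>f \<in> S\<close> the chain \<open>f a\<close>, \<open>f b\<close>,
    \<open>s b\<close> ascends, so \<open>s b\<close> is an upper bound at \<open>a\<close> that
    lies in \<open>M\<close>; leastness of \<open>s a\<close> puts it below
    \<open>s b\<close>.\<close>
  have mono: "r (s a) (s b)" if "a \<in> X" "b \<in> X" "leX a b" for a b
  proof -
    have "r (f a) (s b)" if "f \<in> S" for f
    proof (rule transp_onD[OF trans])
      show "r (f a) (f b)" "r (f b) (s b)" "f a \<in> M" "f b \<in> M" "s b \<in> M"
        using subsetD[OF S that] that \<open>a \<in> X\<close> \<open>b \<in> X\<close> \<open>leX a b\<close> s[of b] \<open>L \<subseteq> M\<close>
        by (auto dest: PiE_mem)
    qed
    then show ?thesis
      using s[of a] s(1)[of b] that \<open>L \<subseteq> M\<close> by auto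
  qed
  show "\<exists>s\<in>?L. (\<forall>f\<in>S. fun_le X r f s) \<and> (\<forall>b\<in>F. (\<forall>f\<in>S. fun_le X r f b) \<longrightarrow> fun_le X r s b)"
  proof (intro bexI[of _ "restrict s X"] conjI ballI impI)
    fix b assume "b \<in> F" "\<forall>f\<in>S. fun_le X r f b"
    then show "fun_le X r (restrict s X) b"
      using s(3) subsetD[OF F] by (simp add: fun_le_def) (meson Pi_mem)
  qed (use s mono in \<open>auto simp: fun_le_def\<close>)
qed

text \<open>The order on the image is pulled back along the left inverse \<open>g\<close>, so the
  supremum is taken after applying \<open>g\<close> and sent forward by \<open>i\<close>.\<close>

lemma lub_closed_image:
  assumes lubs: "lub_closed L M r" and "L \<subseteq> M" and gi: "\<And>x. x \<in> M \<Longrightarrow> g (i x) = x"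
  shows "lub_closed (i ` L) (i ` M) (\<lambda>x y. r (g x) (g y))"
proof (rule lub_closedI)
  fix S assume S: "S \<subseteq> i ` L"
  have "g ` S \<subseteq> L" using S gi \<open>L \<subseteq> M\<close> by force
  from lub_closed_image_lub[OF lubs this] obtain s where
    s: "s \<in> L" "\<forall>x\<in>S. r (g x) s" "\<forall>b\<in>M. (\<forall>x\<in>S. r (g x) b) \<longrightarrow> r s b"
    by metis
  have "g (i s) = s" using s(1) gi \<open>L \<subseteq> M\<close> by blast
  then show "\<exists>s\<in>i ` L. (\<forall>x\<in>S. r (g x) (g s)) \<and>
      (\<forall>b\<in>i ` M. (\<forall>x\<in>S. r (g x) (g b)) \<longrightarrow> r (g s) (g b))"
    using s gi by (intro bexI[of _ "i s"]) auto
qed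

section \<open>Closure of approximation tuples under the three constructions\<close>

lemma approximation_tuple_times:
  assumes "approximation_tuple L1 U1 r1" "approximation_tuple L2 U2 r2"
  shows "approximation_tuple (L1 \<times> L2) (U1 \<times> U2) (prod_le r1 r2)"
proof -
  interpret A: approximation_tuple L1 U1 r1 by fact
  interpret B: approximation_tuple L2 U2 r2 by fact
  \<comment> \<open>\<open>L1 \<times> L2 \<union> U1 \<times> U2\<close> is not itself a product,
    so the order axioms and suprema are established on the larger \<open>?M\<close> and then
    restricted.\<close>
  let ?M = "(L1 \<union> U1) \<times> (L2 \<union> U2)"
  have sub: "L1 \<times> L2 \<union> U1 \<times> U2 \<subseteq> ?M" by auto
  have "reflp_on ?M (prod_le r1 r2)"
    using A.order_on(1) B.order_on(1)
    by (intro reflp_onI) (auto simp: prod_le_def dest: reflp_onD)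
  moreover have "antisymp_on ?M (prod_le r1 r2)"
    using antisymp_onD[OF A.order_on(2)] antisymp_onD[OF B.order_on(2)]
    by (intro antisymp_onI prod_eqI) (auto simp: prod_le_def)
  moreover have "transp_on ?M (prod_le r1 r2)"
    using transp_onD[OF A.order_on(3)] transp_onD[OF B.order_on(3)]
    by (intro transp_onI) (simp add: prod_le_def mem_Times_iff, blast)
  moreover obtain t1 t2 where "t1 \<in> L1 \<inter> U1" "\<forall>x\<in>L1 \<union> U1. r1 x t1"
      "t2 \<in> L2 \<inter> U2" "\<forall>x\<in>L2 \<union> U2. r2 x t2"
    using A.top_elt B.top_elt by blast
  then have "\<exists>t\<in>(L1 \<times> L2) \<inter> (U1 \<times> U2). \<forall>x\<in>L1 \<times> L2 \<union> U1 \<times> U2. prod_le r1 r2 x t"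
    by (intro bexI[of _ "(t1, t2)"]) (auto simp: prod_le_def)
  moreover obtain b1 b2 where "b1 \<in> L1 \<inter> U1" "\<forall>x\<in>L1 \<union> U1. r1 b1 x"
      "b2 \<in> L2 \<inter> U2" "\<forall>x\<in>L2 \<union> U2. r2 b2 x"
    using A.bottom_elt B.bottom_elt by blast
  then have "\<exists>b\<in>(L1 \<times> L2) \<inter> (U1 \<times> U2). \<forall>x\<in>L1 \<times> L2 \<union> U1 \<times> U2. prod_le r1 r2 b x"
    by (intro bexI[of _ "(b1, b2)"]) (auto simp: prod_le_def)
  ultimately show ?thesis
    using lub_closed_mono[OF lub_closed_times[OF A.lub_closed_L B.lub_closed_L] sub]
      lub_closed_mono[OF lub_closed_times[OF A.lub_closed_U B.lub_closed_U] sub]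
      reflp_on_subset[OF _ sub] antisymp_on_subset[OF _ sub] transp_on_subset[OF _ sub]
    by (intro approximation_tupleI) (simp_all add: prod_le_conversep)
qed

text \<open>An antitone map into \<open>U\<close> is a monotone map into \<open>U\<close> with the
  reversed order, so \<open>lub_closed_funcset\<close> serves both components.\<close>

lemma approximation_tuple_funcset:
  fixes X :: "'a set" and leX :: "'a \<Rightarrow> 'a \<Rightarrow> bool"
  assumes "approximation_tuple L U r"
  shows "approximation_tuple
      {f \<in> X \<rightarrow>\<^sub>E L. \<forall>a\<in>X. \<forall>b\<in>X. leX a b \<longrightarrow> r (f a) (f b)}
      {f \<in> X \<rightarrow>\<^sub>E U. \<forall>a\<in>X. \<forall>b\<in>X. leX a b \<longrightarrow> r (f b) (f a)} (fun_le X r)"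
    (is "approximation_tuple ?L ?U _")
proof -
  interpret approximation_tuple L U r by fact
  let ?M = "X \<rightarrow>\<^sub>E (L \<union> U)"
  have sub: "?L \<union> ?U \<subseteq> ?M" by (auto simp: PiE_def)
  then have sub': "?L \<union> ?U \<subseteq> X \<rightarrow> (L \<union> U)" by (auto simp: PiE_iff)
  have "reflp_on ?M (fun_le X r)"
    using reflp_onD[OF order_on(1)] by (intro reflp_onI) (auto simp: fun_le_def PiE_iff)
  moreover have "antisymp_on ?M (fun_le X r)"
    using antisymp_onD[OF order_on(2)]
    by (intro antisymp_onI PiE_ext) (auto simp: fun_le_def PiE_iff)
  moreover have "transp_on ?M (fun_le X r)"
    using transp_onD[OF order_on(3)]
    by (intro transp_onI) (simp add: fun_le_def PiE_iff, blast)
  \<comment> \<open>Constant maps are both monotone and antitone, so constant top and constant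
    bottom lie in \<open>?L \<inter> ?U\<close>.\<close>
  moreover obtain t where t: "t \<in> L \<inter> U" "\<forall>x\<in>L \<union> U. r x t"
    using top_elt by blast
  then have "\<exists>t\<in>?L \<inter> ?U. \<forall>f\<in>?L \<union> ?U. fun_le X r f t"
    by (intro bexI[of _ "\<lambda>x\<in>X. t"]) (auto simp: fun_le_def PiE_iff)
  moreover obtain b where b: "b \<in> L \<inter> U" "\<forall>x\<in>L \<union> U. r b x"
    using bottom_elt by blast
  then have "\<exists>b\<in>?L \<inter> ?U. \<forall>f\<in>?L \<union> ?U. fun_le X r b f"
    by (intro bexI[of _ "\<lambda>x\<in>X. b"]) (auto simp: fun_le_def PiE_iff)
  moreover have "lub_closed ?L (?L \<union> ?U) (fun_le X r)"
    by (rule lub_closed_funcset[OF lub_closed_L _ order_on(3) sub']) simp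
  moreover have "lub_closed ?U (?L \<union> ?U) (fun_le X r\<inverse>\<inverse>)"
    using lub_closed_funcset[OF lub_closed_U _ _ sub', of leX] order_on(3) by simp
  ultimately show ?thesis
    using reflp_on_subset[OF _ sub] antisymp_on_subset[OF _ sub] transp_on_subset[OF _ sub]
    by (intro approximation_tupleI) (simp_all add: fun_le_conversep)
qed

lemma approximation_tuple_image:
  assumes "approximation_tuple L U r" and gi: "\<And>x. x \<in> L \<union> U \<Longrightarrow> g (i x) = x"
  shows "approximation_tuple (i ` L) (i ` U) (\<lambda>x y. r (g x) (g y))" (is "approximation_tuple _ _ ?r")
proof (rule approximation_tupleI)
  interpret approximation_tuple L U r by fact
  have g: "g x \<in> L \<union> U" "i (g x) = x" if "x \<in> i ` L \<union> i ` U" for x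
    using that gi by auto
  show "reflp_on (i ` L \<union> i ` U) ?r"
    using reflp_onD[OF order_on(1)] g(1) by (intro reflp_onI) blast
  show "antisymp_on (i ` L \<union> i ` U) ?r"
  proof (rule antisymp_onI)
    fix x y assume xy: "x \<in> i ` L \<union> i ` U" "y \<in> i ` L \<union> i ` U" "?r x y" "?r y x"
    have "g x = g y"
      by (rule antisymp_onD[OF order_on(2) g(1)[OF xy(1)] g(1)[OF xy(2)] xy(3,4)])
    with g(2)[OF xy(1)] g(2)[OF xy(2)] show "x = y"
      by metis
  qed
  show "transp_on (i ` L \<union> i ` U) ?r"
    using transp_onD[OF order_on(3) g(1) g(1) g(1)] by (rule transp_onI)
  obtain t where "t \<in> L \<inter> U" "\<forall>x\<in>L \<union> U. r x t"
    using top_elt by blast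
  then show "\<exists>t\<in>i ` L \<inter> i ` U. \<forall>x\<in>i ` L \<union> i ` U. ?r x t"
    using g(1) gi[of t] by (intro bexI[of _ "i t"]) auto
  obtain b where "b \<in> L \<inter> U" "\<forall>x\<in>L \<union> U. r b x"
    using bottom_elt by blast
  then show "\<exists>b\<in>i ` L \<inter> i ` U. \<forall>x\<in>i ` L \<union> i ` U. ?r b x"
    using g(1) gi[of b] by (intro bexI[of _ "i b"]) auto
  show "lub_closed (i ` L) (i ` L \<union> i ` U) ?r"
    using lub_closed_image[where g = g and i = i, OF lub_closed_L] gi by (simp add: image_Un)
  show "lub_closed (i ` U) (i ` L \<union> i ` U) ?r\<inverse>\<inverse>"
  proof -
    have "?r\<inverse>\<inverse> = (\<lambda>x y. r\<inverse>\<inverse> (g x) (g y))"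
      by (simp add: fun_eq_iff)
    then show ?thesis
      using lub_closed_image[where g = g and i = i, OF lub_closed_U] gi by (simp add: image_Un)
  qed
qed

section \<open>Products and exponentials of posets with monotone functions\<close>

text \<open>The two posets may live on different types: products and posets of maps are built over
  types other than that of the objects, and can be compared with objects only up to
  isomorphism.\<close>

definition order_iso :: "'a gorder \<Rightarrow> 'b gorder \<Rightarrow> ('a \<Rightarrow> 'b) \<Rightarrow> bool" where
  "order_iso P Q \<phi> \<longleftrightarrow> bij_betw \<phi> (carrier P) (carrier Q) \<and>
     (\<forall>x\<in>carrier P. \<forall>y\<in>carrier P. x \<sqsubseteq>\<^bsub>P\<^esub> y \<longleftrightarrow> \<phi> x \<sqsubseteq>\<^bsub>Q\<^esub> \<phi> y)"

lemma order_iso_compose: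
  assumes "order_iso P Q \<phi>" "order_iso Q R \<psi>"
  shows "order_iso P R (\<psi> \<circ> \<phi>)"
  using assms bij_betw_apply[of \<phi> "carrier P" "carrier Q"]
  by (auto simp: order_iso_def intro: bij_betw_trans)

lemma order_iso_inv:
  assumes "order_iso P Q \<phi>" "y \<in> carrier Q"
  shows "inv_into (carrier P) \<phi> y \<in> carrier P" "\<phi> (inv_into (carrier P) \<phi> y) = y"
  using assms by (auto simp: order_iso_def bij_betw_def f_inv_into_f inv_into_into)

lemma order_iso_inv_apply:
  assumes "order_iso P Q \<phi>" "x \<in> carrier P"
  shows "\<phi> x \<in> carrier Q" "inv_into (carrier P) \<phi> (\<phi> x) = x"
  using assms by (auto simp: order_iso_def bij_betw_def inv_into_f_f)

lemma order_iso_inv_le_iff: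
  assumes "order_iso P Q \<phi>" "y \<in> carrier Q" "z \<in> carrier Q"
  shows "inv_into (carrier P) \<phi> y \<sqsubseteq>\<^bsub>P\<^esub> inv_into (carrier P) \<phi> z \<longleftrightarrow> y \<sqsubseteq>\<^bsub>Q\<^esub> z"
  using assms order_iso_inv[OF assms(1)] unfolding order_iso_def by metis

section \<open>Order products and posets of monotone maps\<close>

definition prod_poset :: "'a gorder \<Rightarrow> 'b gorder \<Rightarrow> ('a \<times> 'b) gorder" where
  "prod_poset P Q = poset_on (carrier P \<times> carrier Q) (prod_le (le P) (le Q))"

text \<open>This drops the order axioms for \<open>P\<close> and \<open>Q\<close> that
  \<open>isotone\<close> includes. Between objects of a category of posets the two notions agree, by
  \<open>Hom_eq\<close>.\<close>

definition monotone_maps :: "'a gorder \<Rightarrow> 'b gorder \<Rightarrow> ('a \<Rightarrow> 'b) set" where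
  "monotone_maps P Q = {f \<in> carrier P \<rightarrow>\<^sub>E carrier Q.
     \<forall>x\<in>carrier P. \<forall>y\<in>carrier P. x \<sqsubseteq>\<^bsub>P\<^esub> y \<longrightarrow> f x \<sqsubseteq>\<^bsub>Q\<^esub> f y}"

definition map_poset :: "'a gorder \<Rightarrow> 'b gorder \<Rightarrow> ('a \<Rightarrow> 'b) gorder" where
  "map_poset P Q = poset_on (monotone_maps P Q) (fun_le (carrier P) (le Q))"

lemma monotone_mapsI:
  assumes "\<And>x. x \<in> carrier P \<Longrightarrow> f x \<in> carrier Q" "\<And>x. x \<notin> carrier P \<Longrightarrow> f x = undefined"
    and "\<And>x y. x \<in> carrier P \<Longrightarrow> y \<in> carrier P \<Longrightarrow> x \<sqsubseteq>\<^bsub>P\<^esub> y \<Longrightarrow> f x \<sqsubseteq>\<^bsub>Q\<^esub> f y"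
  shows "f \<in> monotone_maps P Q"
  using assms by (auto simp: monotone_maps_def)

lemma monotone_mapsD:
  assumes "f \<in> monotone_maps P Q"
  shows "x \<in> carrier P \<Longrightarrow> f x \<in> carrier Q"
    and "x \<in> carrier P \<Longrightarrow> y \<in> carrier P \<Longrightarrow> x \<sqsubseteq>\<^bsub>P\<^esub> y \<Longrightarrow> f x \<sqsubseteq>\<^bsub>Q\<^esub> f y"
  using assms by (auto simp: monotone_maps_def)

lemma monotone_maps_ext:
  assumes "f \<in> monotone_maps P Q" "g \<in> monotone_maps P Q" "\<And>x. x \<in> carrier P \<Longrightarrow> f x = g x"
  shows "f = g"
  using assms by (auto simp: monotone_maps_def intro: PiE_ext)

lemma monotone_maps_compose:
  assumes "f \<in> monotone_maps P Q" "g \<in> monotone_maps Q R"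
  shows "(\<lambda>x\<in>carrier P. g (f x)) \<in> monotone_maps P R"
  using assms by (intro monotone_mapsI) (simp_all add: monotone_mapsD)

text \<open>Stated for an arbitrary set of posets because both the approximation spaces and the
  chain-complete posets are instances.\<close>

locale poset_category =
  fixes K :: "'a gorder set"
  assumes posets: "P \<in> K \<Longrightarrow> partial_order P"
begin

abbreviation "C \<equiv> monotone_category K"

lemma Ob_eq [simp]: "Ob C = K"
  and Id_eq [simp]: "Id C P = (\<lambda>x\<in>carrier P. x)"
  and Cmp_eq [simp]: "Cmp C P Q R g f = (\<lambda>x\<in>carrier P. g (f x))"
  by (simp_all add: monotone_category_def compose_def)

lemma Hom_eq: "P \<in> K \<Longrightarrow> Q \<in> K \<Longrightarrow> Hom C P Q = monotone_maps P Q"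
  using posets
  by (auto simp: monotone_category_def monotone_maps_def isotone_def partial_order_def)

lemma category: "category C"
proof
  fix P assume "P \<in> Ob C"
  then show "Id C P \<in> Hom C P P"
    by (auto simp: Hom_eq intro: monotone_mapsI)
next
  fix P Q R f g assume "P \<in> Ob C" "Q \<in> Ob C" "R \<in> Ob C" "f \<in> Hom C P Q" "g \<in> Hom C Q R"
  then show "Cmp C P Q R g f \<in> Hom C P R"
    by (auto simp: Hom_eq intro!: monotone_mapsI dest: monotone_mapsD)
next
  fix P Q f assume "P \<in> Ob C" "Q \<in> Ob C" "f \<in> Hom C P Q"
  then have f: "f \<in> monotone_maps P Q" by (simp add: Hom_eq)
  then show "Cmp C P Q Q (Id C Q) f = f" "Cmp C P P Q f (Id C P) = f"
    by (auto simp: monotone_maps_def fun_eq_iff)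
next
  fix P Q R S f g h
  assume "P \<in> Ob C" "Q \<in> Ob C" "R \<in> Ob C" "S \<in> Ob C" "f \<in> Hom C P Q" "g \<in> Hom C Q R" "h \<in> Hom C R S"
  then have "f \<in> monotone_maps P Q" by (simp add: Hom_eq)
  then show "Cmp C P R S h (Cmp C P Q R g f) = Cmp C P Q S (Cmp C Q R S h g) f"
    by (auto simp: fun_eq_iff dest: monotone_mapsD)
qed

section \<open>Terminal objects and binary products\<close>

lemma is_terminalI:
  assumes "T \<in> K" "carrier T = {t}"
  shows "is_terminal C T"
  unfolding is_terminal_def
proof (intro conjI ballI ex1I)
  interpret T: partial_order T using assms(1) posets by blast
  fix P assume P: "P \<in> Ob C"
  show "(\<lambda>x\<in>carrier P. t) \<in> Hom C P T"
    using P assms T.le_refl[of t] by (auto simp: Hom_eq intro!: monotone_mapsI)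
  fix f assume "f \<in> Hom C P T"
  then show "f = (\<lambda>x\<in>carrier P. t)"
    using P assms by (auto simp: Hom_eq monotone_maps_def fun_eq_iff PiE_iff extensional_def)
qed (use assms in simp)

text \<open>The mediating map pairs \<open>f\<close> and \<open>g\<close> in the order product and
  then applies the inverse of \<open>\<pi>\<close>; it is monotone because \<open>\<pi>\<close>
  reflects the order.\<close>

lemma is_product_of_order_iso:
  assumes K: "A \<in> K" "B \<in> K" "P \<in> K" and \<pi>: "order_iso P (prod_poset A B) \<pi>"
  shows "is_product C A B P (\<lambda>z\<in>carrier P. fst (\<pi> z)) (\<lambda>z\<in>carrier P. snd (\<pi> z))"
proof -
  let ?i = "inv_into (carrier P) \<pi>"
  have \<pi>_mem: "fst (\<pi> z) \<in> carrier A" "snd (\<pi> z) \<in> carrier B" if "z \<in> carrier P" for z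
    using order_iso_inv_apply(1)[OF \<pi> that] by (auto simp: prod_poset_def)
  have \<pi>_mono: "fst (\<pi> z) \<sqsubseteq>\<^bsub>A\<^esub> fst (\<pi> z')" "snd (\<pi> z) \<sqsubseteq>\<^bsub>B\<^esub> snd (\<pi> z')"
    if "z \<in> carrier P" "z' \<in> carrier P" "z \<sqsubseteq>\<^bsub>P\<^esub> z'" for z z'
    using \<pi> that by (auto simp: order_iso_def prod_poset_def prod_le_def)
  have univ: "\<exists>!h. h \<in> monotone_maps X P \<and> (\<lambda>x\<in>carrier X. (\<lambda>z\<in>carrier P. fst (\<pi> z)) (h x)) = f \<and>
      (\<lambda>x\<in>carrier X. (\<lambda>z\<in>carrier P. snd (\<pi> z)) (h x)) = g"
    if f: "f \<in> monotone_maps X A" and g: "g \<in> monotone_maps X B" for X f g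
  proof (rule ex1I)
    let ?h = "\<lambda>x\<in>carrier X. ?i (f x, g x)"
    have fg: "(f x, g x) \<in> carrier (prod_poset A B)" if "x \<in> carrier X" for x
      using f g that by (simp add: prod_poset_def monotone_mapsD)
    have "?h \<in> monotone_maps X P"
    proof (rule monotone_mapsI)
      fix x y assume "x \<in> carrier X" "y \<in> carrier X" "x \<sqsubseteq>\<^bsub>X\<^esub> y"
      then show "?h x \<sqsubseteq>\<^bsub>P\<^esub> ?h y"
        using order_iso_inv_le_iff[OF \<pi> fg fg] monotone_mapsD(2)[OF f] monotone_mapsD(2)[OF g]
        by (simp add: prod_poset_def prod_le_def)
    qed (use order_iso_inv(1)[OF \<pi> fg] in auto)
    moreover have "(\<lambda>x\<in>carrier X. fst (\<pi> (?i (f x, g x)))) = f"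
      "(\<lambda>x\<in>carrier X. snd (\<pi> (?i (f x, g x)))) = g"
      using order_iso_inv(2)[OF \<pi> fg] f g
      by (auto simp: fun_eq_iff monotone_maps_def PiE_iff extensional_def)
    ultimately show "?h \<in> monotone_maps X P \<and>
        (\<lambda>x\<in>carrier X. (\<lambda>z\<in>carrier P. fst (\<pi> z)) (?h x)) = f \<and>
        (\<lambda>x\<in>carrier X. (\<lambda>z\<in>carrier P. snd (\<pi> z)) (?h x)) = g"
      using order_iso_inv(1)[OF \<pi> fg] by (simp cong: restrict_cong)
    fix h assume h: "h \<in> monotone_maps X P \<and>
        (\<lambda>x\<in>carrier X. (\<lambda>z\<in>carrier P. fst (\<pi> z)) (h x)) = f \<and>
        (\<lambda>x\<in>carrier X. (\<lambda>z\<in>carrier P. snd (\<pi> z)) (h x)) = g"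
    show "h = ?h"
    proof (rule monotone_maps_ext)
      fix x assume x: "x \<in> carrier X"
      then have "h x \<in> carrier P" using h monotone_mapsD(1)[of h X P] by blast
      moreover have "f x = fst (\<pi> (h x))" "g x = snd (\<pi> (h x))"
        using h x \<open>h x \<in> carrier P\<close> by auto
      ultimately show "h x = ?h x"
        using x order_iso_inv_apply(2)[OF \<pi>, of "h x"] by simp
    qed (use h \<open>?h \<in> monotone_maps X P\<close> in auto)
  qed
  have proj: "(\<lambda>z\<in>carrier P. fst (\<pi> z)) \<in> monotone_maps P A"
    "(\<lambda>z\<in>carrier P. snd (\<pi> z)) \<in> monotone_maps P B"
    using \<pi>_mem \<pi>_mono by (auto intro!: monotone_mapsI)
  show ?thesis
    unfolding is_product_def Ob_eq Cmp_eq
  proof (intro conjI ballI)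
    fix X f g assume "X \<in> K" "f \<in> Hom C X A" "g \<in> Hom C X B"
    then show "\<exists>!h. h \<in> Hom C X P \<and> (\<lambda>x\<in>carrier X. (\<lambda>z\<in>carrier P. fst (\<pi> z)) (h x)) = f \<and>
        (\<lambda>x\<in>carrier X. (\<lambda>z\<in>carrier P. snd (\<pi> z)) (h x)) = g"
      using univ[of f X g] K by (simp add: Hom_eq del: restrict_apply)
  qed (use K proj in \<open>simp_all add: Hom_eq\<close>)
qed

lemma is_productD:
  assumes "is_product C A B P p q" "A \<in> K" "B \<in> K"
  shows "P \<in> K" "p \<in> monotone_maps P A" "q \<in> monotone_maps P B"
  using assms by (auto simp: is_product_def Hom_eq)

lemma is_product_ex1:
  assumes P: "is_product C A B P p q" "A \<in> K" "B \<in> K" and "X \<in> K"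
    and "f \<in> monotone_maps X A" "g \<in> monotone_maps X B"
  shows "\<exists>!h. h \<in> monotone_maps X P \<and> (\<lambda>x\<in>carrier X. p (h x)) = f \<and> (\<lambda>x\<in>carrier X. q (h x)) = g"
  using assms is_productD[OF P] by (simp add: is_product_def Hom_eq)

lemma is_product_lift:
  assumes "is_product C A B P p q" "A \<in> K" "B \<in> K" "X \<in> K"
    and "f \<in> monotone_maps X A" "g \<in> monotone_maps X B"
  obtains h where "h \<in> monotone_maps X P"
    "\<forall>x\<in>carrier X. p (h x) = f x" "\<forall>x\<in>carrier X. q (h x) = g x"
proof -
  obtain h where h: "h \<in> monotone_maps X P"
    "(\<lambda>x\<in>carrier X. p (h x)) = f" "(\<lambda>x\<in>carrier X. q (h x)) = g"
    using ex1_implies_ex[OF is_product_ex1[OF assms]] by blast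
  show thesis
    by (rule that[of h]) (use h in auto)
qed

text \<open>The projections are jointly monic, since \<open>h\<close> and \<open>k\<close> both
  mediate for the composites of \<open>h\<close> with \<open>p\<close> and \<open>q\<close>.\<close>

lemma is_product_eqI:
  assumes P: "is_product C A B P p q" "A \<in> K" "B \<in> K" and X: "X \<in> K"
    and h: "h \<in> monotone_maps X P" and k: "k \<in> monotone_maps X P"
    and eq: "\<And>x. x \<in> carrier X \<Longrightarrow> p (h x) = p (k x)" "\<And>x. x \<in> carrier X \<Longrightarrow> q (h x) = q (k x)"
  shows "h = k"
proof -
  have "(\<lambda>x\<in>carrier X. p (k x)) = (\<lambda>x\<in>carrier X. p (h x))"
    "(\<lambda>x\<in>carrier X. q (k x)) = (\<lambda>x\<in>carrier X. q (h x))"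
    using eq by auto
  with is_product_ex1[OF P X monotone_maps_compose[OF h] monotone_maps_compose[OF h]]
    is_productD(2,3)[OF P] h k
  show ?thesis by blast
qed

text \<open>Being unique up to isomorphism, every categorical product \<open>Q\<close> of \<open>X\<close> and \<open>A\<close> is the order
  product as soon as some object is; \<open>w\<close> is the pairing.\<close>

lemma is_product_pairing:
  assumes K: "X \<in> K" "A \<in> K" "P \<in> K" and \<pi>: "order_iso P (prod_poset X A) \<pi>"
    and Q: "is_product C X A Q p q"
  obtains w where "\<forall>x\<in>carrier X. \<forall>a\<in>carrier A. w x a \<in> carrier Q \<and> p (w x a) = x \<and> q (w x a) = a"
    and "\<forall>x\<in>carrier X. \<forall>x'\<in>carrier X. \<forall>a\<in>carrier A. \<forall>a'\<in>carrier A.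
      x \<sqsubseteq>\<^bsub>X\<^esub> x' \<longrightarrow> a \<sqsubseteq>\<^bsub>A\<^esub> a' \<longrightarrow> w x a \<sqsubseteq>\<^bsub>Q\<^esub> w x' a'"
    and "\<forall>z\<in>carrier Q. w (p z) (q z) = z"
proof -
  let ?p = "\<lambda>z\<in>carrier P. fst (\<pi> z)" and ?q = "\<lambda>z\<in>carrier P. snd (\<pi> z)"
  have P: "is_product C X A P ?p ?q"
    by (rule is_product_of_order_iso[OF K \<pi>])
  note Q' = is_productD[OF Q K(1,2)] and P' = is_productD[OF P K(1,2)]
  \<comment> \<open>\<open>u\<close> and \<open>v\<close> are the comparison maps between the object
    \<open>P\<close> and the given product \<open>Q\<close>; both commute with the
    projections.\<close>
  obtain u where u: "u \<in> monotone_maps P Q" "\<forall>z\<in>carrier P. p (u z) = ?p z"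
    "\<forall>z\<in>carrier P. q (u z) = ?q z"
    by (rule is_product_lift[OF Q K(1,2) P'])
  obtain v where v: "v \<in> monotone_maps Q P" "\<forall>z\<in>carrier Q. ?p (v z) = p z"
    "\<forall>z\<in>carrier Q. ?q (v z) = q z"
    by (rule is_product_lift[OF P K(1,2) Q'])
  \<comment> \<open>Both maps have the same projections. This half of the isomorphism is what yields
    \<open>w (p z) (q z) = z\<close>.\<close>
  have "(\<lambda>z\<in>carrier Q. u (v z)) = (\<lambda>z\<in>carrier Q. z)"
  proof (rule is_product_eqI[OF Q K(1,2) Q'(1) monotone_maps_compose[OF v(1) u(1)]])
    show "(\<lambda>z\<in>carrier Q. z) \<in> monotone_maps Q Q"
      by (auto intro: monotone_mapsI)
    fix z assume "z \<in> carrier Q"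
    moreover from this have "v z \<in> carrier P"
      by (rule monotone_mapsD(1)[OF v(1)])
    ultimately show "p ((\<lambda>z\<in>carrier Q. u (v z)) z) = p ((\<lambda>z\<in>carrier Q. z) z)"
      "q ((\<lambda>z\<in>carrier Q. u (v z)) z) = q ((\<lambda>z\<in>carrier Q. z) z)"
      using u(2,3)[THEN bspec, of "v z"] v(2,3)[THEN bspec, of z] by simp_all
  qed
  then have uv: "u (v z) = z" if "z \<in> carrier Q" for z
    using that by (metis restrict_apply')
  let ?i = "inv_into (carrier P) \<pi>"
  have mem: "(x, a) \<in> carrier (prod_poset X A)" if "x \<in> carrier X" "a \<in> carrier A" for x a
    using that by (simp add: prod_poset_def)
  show thesis
  proof (rule that[of "\<lambda>x a. u (?i (x, a))"]; intro ballI impI)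
    fix x a assume "x \<in> carrier X" "a \<in> carrier A"
    note i = order_iso_inv[OF \<pi> mem[OF this]]
    then show "u (?i (x, a)) \<in> carrier Q \<and> p (u (?i (x, a))) = x \<and> q (u (?i (x, a))) = a"
      using u monotone_mapsD(1)[OF u(1)] by simp
  next
    fix x x' a a'
    assume *: "x \<in> carrier X" "x' \<in> carrier X" "a \<in> carrier A" "a' \<in> carrier A"
      "x \<sqsubseteq>\<^bsub>X\<^esub> x'" "a \<sqsubseteq>\<^bsub>A\<^esub> a'"
    then have "?i (x, a) \<sqsubseteq>\<^bsub>P\<^esub> ?i (x', a')"
      using order_iso_inv_le_iff[OF \<pi> mem mem] by (simp add: prod_poset_def prod_le_def)
    then show "u (?i (x, a)) \<sqsubseteq>\<^bsub>Q\<^esub> u (?i (x', a'))"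
      using * order_iso_inv(1)[OF \<pi> mem] by (intro monotone_mapsD(2)[OF u(1)])
  next
    fix z assume z: "z \<in> carrier Q"
    have vz: "v z \<in> carrier P" using z v(1) by (rule monotone_mapsD(1)[rotated])
    then have "\<pi> (v z) = (p z, q z)"
      using v(2,3)[THEN bspec, OF z] by (simp add: prod_eq_iff)
    then have "?i (p z, q z) = v z"
      using order_iso_inv_apply(2)[OF \<pi> vz] by simp
    then show "u (?i (p z, q z)) = z"
      using uv[OF z] by simp
  qed
qed

text \<open>Evaluation is application after \<open>\<epsilon>\<close>, and the transpose of an arrow
  is its curried form. The universal property ranges over every categorical product \<open>Q\<close>
  of \<open>X\<close> and \<open>A\<close>, so currying goes through the pairing \<open>w\<close> of
  \<open>is_product_pairing\<close>.\<close>

lemma has_exponential_of_order_iso: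
  assumes prods: "\<And>A B. A \<in> K \<Longrightarrow> B \<in> K \<Longrightarrow> \<exists>P\<in>K. \<exists>\<pi>. order_iso P (prod_poset A B) \<pi>"
    and K: "A \<in> K" "B \<in> K" "E \<in> K" and \<epsilon>: "order_iso E (map_poset A B) \<epsilon>"
  shows "has_exponential C A B"
proof -
  interpret B: partial_order B using posets K by blast
  obtain P \<pi> where P: "P \<in> K" and \<pi>: "order_iso P (prod_poset E A) \<pi>"
    using prods K by blast
  let ?p = "\<lambda>z\<in>carrier P. fst (\<pi> z)" and ?q = "\<lambda>z\<in>carrier P. snd (\<pi> z)"
  have prod: "is_product C E A P ?p ?q"
    by (rule is_product_of_order_iso[OF K(3,1) P \<pi>])
  note pq = is_productD(2,3)[OF prod K(3,1)]
  let ?ev = "\<lambda>z\<in>carrier P. \<epsilon> (fst (\<pi> z)) (snd (\<pi> z))"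
  let ?j = "inv_into (carrier E) \<epsilon>"
  have \<epsilon>_map: "\<epsilon> e \<in> monotone_maps A B" if "e \<in> carrier E" for e
    using order_iso_inv_apply(1)[OF \<epsilon> that] by (simp add: map_poset_def)
  have \<epsilon>_le: "\<epsilon> e a \<sqsubseteq>\<^bsub>B\<^esub> \<epsilon> e' a'"
    if "e \<in> carrier E" "e' \<in> carrier E" "a \<in> carrier A" "a' \<in> carrier A" "e \<sqsubseteq>\<^bsub>E\<^esub> e'" "a \<sqsubseteq>\<^bsub>A\<^esub> a'" for e e' a a'
  proof (rule B.le_trans)
    show "\<epsilon> e a \<sqsubseteq>\<^bsub>B\<^esub> \<epsilon> e a'"
      using that by (intro monotone_mapsD(2)[OF \<epsilon>_map])
    show "\<epsilon> e a' \<sqsubseteq>\<^bsub>B\<^esub> \<epsilon> e' a'"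
      using \<epsilon> that by (auto simp: order_iso_def map_poset_def fun_le_def)
  qed (use that monotone_mapsD(1)[OF \<epsilon>_map] in auto)
  have \<pi>_mem: "fst (\<pi> z) \<in> carrier E" "snd (\<pi> z) \<in> carrier A" if "z \<in> carrier P" for z
    using order_iso_inv_apply(1)[OF \<pi> that] by (auto simp: prod_poset_def)
  have ev: "?ev \<in> monotone_maps P B"
  proof (rule monotone_mapsI)
    fix z z' assume "z \<in> carrier P" "z' \<in> carrier P" "z \<sqsubseteq>\<^bsub>P\<^esub> z'"
    then show "?ev z \<sqsubseteq>\<^bsub>B\<^esub> ?ev z'"
      using \<pi> \<pi>_mem by (auto simp: order_iso_def prod_poset_def prod_le_def intro!: \<epsilon>_le)
  qed (use \<pi>_mem monotone_mapsD(1)[OF \<epsilon>_map] in auto)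
  have univ: "\<exists>!h. h \<in> monotone_maps X E \<and>
      (\<exists>k\<in>monotone_maps Q P. (\<lambda>z\<in>carrier Q. ?p (k z)) = (\<lambda>z\<in>carrier Q. h (p' z)) \<and>
        (\<lambda>z\<in>carrier Q. ?q (k z)) = q' \<and> (\<lambda>z\<in>carrier Q. ?ev (k z)) = g)"
      (is "\<exists>!h. ?univ h")
    if X: "X \<in> K" and Q: "is_product C X A Q p' q'" and g: "g \<in> monotone_maps Q B" for X Q p' q' g
  proof -
    obtain R \<rho> where R: "R \<in> K" and \<rho>: "order_iso R (prod_poset X A) \<rho>"
      using prods X K by blast
    obtain w where
      w: "\<forall>x\<in>carrier X. \<forall>a\<in>carrier A. w x a \<in> carrier Q \<and> p' (w x a) = x \<and> q' (w x a) = a"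
      and w_mono: "\<forall>x\<in>carrier X. \<forall>x'\<in>carrier X. \<forall>a\<in>carrier A. \<forall>a'\<in>carrier A.
        x \<sqsubseteq>\<^bsub>X\<^esub> x' \<longrightarrow> a \<sqsubseteq>\<^bsub>A\<^esub> a' \<longrightarrow> w x a \<sqsubseteq>\<^bsub>Q\<^esub> w x' a'"
      and w_eta: "\<forall>z\<in>carrier Q. w (p' z) (q' z) = z"
      by (rule is_product_pairing[OF X K(1) R \<rho> Q])
    note Q' = is_productD[OF Q X K(1)]
    \<comment> \<open>Reflexivity in \<open>X\<close> and in \<open>A\<close> allows one argument of
      \<open>w\<close> to vary in \<open>w_mono\<close> while the other stays fixed.\<close>
    interpret X: partial_order X using posets X by blast
    interpret A: partial_order A using posets K by blast
    \<comment> \<open>\<open>c x\<close> is \<open>g\<close> curried at \<open>x\<close>;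
      \<open>?h\<close> carries it back to \<open>E\<close>.\<close>
    define c where "c = (\<lambda>x. \<lambda>a\<in>carrier A. g (w x a))"
    have c: "c x \<in> carrier (map_poset A B)" if "x \<in> carrier X" for x
      using that w w_mono monotone_mapsD[OF g]
      by (auto simp: c_def map_poset_def intro!: monotone_mapsI)
    let ?h = "\<lambda>x\<in>carrier X. ?j (c x)"
    have h: "?h \<in> monotone_maps X E"
    proof (rule monotone_mapsI)
      fix x y assume "x \<in> carrier X" "y \<in> carrier X" "x \<sqsubseteq>\<^bsub>X\<^esub> y"
      moreover from this have "c x \<sqsubseteq>\<^bsub>map_poset A B\<^esub> c y"
        using w w_mono monotone_mapsD[OF g] by (auto simp: c_def map_poset_def fun_le_def)
      ultimately show "?h x \<sqsubseteq>\<^bsub>E\<^esub> ?h y"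
        using order_iso_inv_le_iff[OF \<epsilon> c c] by simp
    qed (use order_iso_inv(1)[OF \<epsilon> c] in auto)
    have hp: "(\<lambda>z\<in>carrier Q. ?h (p' z)) \<in> monotone_maps Q E"
      by (rule monotone_maps_compose[OF Q'(2) h])
    \<comment> \<open>\<open>k\<close> is the arrow \<open>?h \<times> id\<close> from
      \<open>Q\<close> to \<open>P\<close>.\<close>
    obtain k where k: "k \<in> monotone_maps Q P"
      and "\<forall>z\<in>carrier Q. ?p (k z) = (\<lambda>z\<in>carrier Q. ?h (p' z)) z"
      and k_snd: "\<forall>z\<in>carrier Q. ?q (k z) = q' z"
      by (rule is_product_lift[OF prod K(3,1) Q'(1) hp Q'(3)])
    then have k_fst: "?p (k z) = ?h (p' z)" if "z \<in> carrier Q" for z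
      using that by (simp del: restrict_apply add: restrict_apply')
    show ?thesis
    proof (rule ex1I)
      \<comment> \<open>\<open>\<epsilon>\<close> undoes \<open>?j\<close>, leaving
        \<open>c (p' z)\<close> applied to \<open>q' z\<close>. This is \<open>g\<close> at
        \<open>w (p' z) (q' z)\<close>, which is \<open>z\<close>.\<close>
      have "?ev (k z) = g z" if z: "z \<in> carrier Q" for z
      proof -
        have "p' z \<in> carrier X" "q' z \<in> carrier A" "k z \<in> carrier P"
          using z by (rule monotone_mapsD(1)[OF Q'(2)], rule monotone_mapsD(1)[OF Q'(3)], rule monotone_mapsD(1)[OF k])
        moreover from this have "?ev (k z) = \<epsilon> (?h (p' z)) (q' z)"
          using k_fst[OF z] k_snd[THEN bspec, OF z] by simp
        ultimately show ?thesis
          using order_iso_inv(2)[OF \<epsilon> c, of "p' z"] z w_eta by (simp add: c_def)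
      qed
      then have "(\<lambda>z\<in>carrier Q. ?ev (k z)) = g"
        using g by (auto simp: fun_eq_iff monotone_maps_def PiE_iff extensional_def)
      moreover have "(\<lambda>z\<in>carrier Q. ?q (k z)) = q'"
        using k_snd Q'(3) by (auto simp: fun_eq_iff monotone_maps_def PiE_iff extensional_def)
      moreover have "(\<lambda>z\<in>carrier Q. ?p (k z)) = (\<lambda>z\<in>carrier Q. ?h (p' z))"
        using k_fst by (rule restrict_ext)
      ultimately show "?univ ?h"
        using h k by blast
    next
      fix h' assume "?univ h'"
      then obtain k' where h': "h' \<in> monotone_maps X E" and k': "k' \<in> monotone_maps Q P"
        and "(\<lambda>z\<in>carrier Q. ?p (k' z)) = (\<lambda>z\<in>carrier Q. h' (p' z))"
          "(\<lambda>z\<in>carrier Q. ?q (k' z)) = q'" "(\<lambda>z\<in>carrier Q. ?ev (k' z)) = g"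
        by blast
      then have eqs: "?p (k' z) = h' (p' z)" "?q (k' z) = q' z" "?ev (k' z) = g z"
        if "z \<in> carrier Q" for z
        using that by (metis (no_types, lifting) restrict_apply')+
      show "h' = ?h"
      proof (rule monotone_maps_ext[OF h' h])
        fix x assume x: "x \<in> carrier X"
        then have hx: "h' x \<in> carrier E" by (rule monotone_mapsD(1)[OF h'])
        \<comment> \<open>The equations for \<open>k'\<close> at the point \<open>w x a\<close>
          determine the value at \<open>a\<close>; injectivity of \<open>\<epsilon>\<close> then
          determines \<open>h' x\<close>.\<close>
        have "\<epsilon> (h' x) = c x"
        proof (rule monotone_maps_ext)
          show "\<epsilon> (h' x) \<in> monotone_maps A B" by (rule \<epsilon>_map[OF hx])
          show "c x \<in> monotone_maps A B" using c[OF x] by (simp add: map_poset_def)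
          fix a assume a: "a \<in> carrier A"
          have wQ: "w x a \<in> carrier Q" using w x a by blast
          then have "k' (w x a) \<in> carrier P" by (rule monotone_mapsD(1)[OF k'])
          then show "\<epsilon> (h' x) a = c x a"
            using eqs[OF wQ] w x a by (simp add: c_def)
        qed
        then show "h' x = ?h x"
          using order_iso_inv_apply(2)[OF \<epsilon> hx] x by simp
      qed
    qed
  qed
  have "is_exponential C A B E P ?p ?q ?ev"
    unfolding is_exponential_def Ob_eq Cmp_eq
  proof (intro conjI ballI allI impI)
    fix X Q p' q' g assume *: "X \<in> K" "is_product C X A Q p' q'" "g \<in> Hom C Q B"
    then show "\<exists>!h. h \<in> Hom C X E \<and>
        (\<exists>k\<in>Hom C Q P. (\<lambda>z\<in>carrier Q. ?p (k z)) = (\<lambda>z\<in>carrier Q. h (p' z)) \<and>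
          (\<lambda>z\<in>carrier Q. ?q (k z)) = q' \<and> (\<lambda>z\<in>carrier Q. ?ev (k z)) = g)"
      using univ[of X Q p' q' g] K P is_productD(1)[OF *(2,1) K(1)]
      by (simp add: Hom_eq del: restrict_apply)
  qed (use K P prod ev in \<open>simp_all add: Hom_eq\<close>)
  then show ?thesis
    unfolding has_exponential_def by blast
qed

end

section \<open>Approximation spaces\<close>

lemma approximation_space_simps:
  "p \<in> carrier (approximation_space L U r) \<longleftrightarrow> fst p \<in> L \<and> snd p \<in> U \<and> r (fst p) (snd p)"
  "p \<sqsubseteq>\<^bsub>approximation_space L U r\<^esub> q \<longleftrightarrow> r (fst p) (fst q) \<and> r (snd q) (snd p)"
  by (cases p; cases q; simp add: approximation_space_def)+

context approximation_tuple
begin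

abbreviation "S \<equiv> approximation_space L U r"

section \<open>Approximation spaces as chain-complete posets\<close>

lemma partial_order_approximation_space: "partial_order S"
  unfolding approximation_space_def partial_order_poset_on_iff
proof (intro conjI)
  let ?S = "{(x, y). x \<in> L \<and> y \<in> U \<and> r x y}"
  let ?r = "\<lambda>(x1, y1) (x2, y2). r x1 x2 \<and> r y2 y1"
  show "reflp_on ?S ?r"
    using reflp_onD[OF order_on(1)] by (intro reflp_onI) auto
  show "antisymp_on ?S ?r"
    using antisymp_onD[OF order_on(2)] by (intro antisymp_onI) auto
  show "transp_on ?S ?r"
    using transp_onD[OF order_on(3)] by (intro transp_onI) (clarsimp, blast)
qed

text \<open>The supremum of a chain pairs the supremum in \<open>L\<close> of the first components
  with the infimum in \<open>U\<close> of the second. The point to check is that this pair is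
  consistent, that is \<open>r s u\<close>.\<close>

lemma chain_complete_approximation_space: "chain_complete S"
  unfolding chain_complete_def
proof (intro conjI allI impI)
  fix T assume T: "T \<subseteq> carrier S" and chain: "\<forall>x\<in>T. \<forall>y\<in>T. x \<sqsubseteq>\<^bsub>S\<^esub> y \<or> y \<sqsubseteq>\<^bsub>S\<^esub> x"
  have mem: "fst x \<in> L" "snd x \<in> U" "r (fst x) (snd x)" if "x \<in> T" for x
    using T that approximation_space_simps(1) by blast+
  have "fst ` T \<subseteq> L" "snd ` T \<subseteq> U"
    using mem by auto
  obtain s where s: "s \<in> L" "\<forall>x\<in>T. r (fst x) s"
    "\<forall>b\<in>L \<union> U. (\<forall>x\<in>T. r (fst x) b) \<longrightarrow> r s b"
    by (rule lub_closed_image_lub[OF lub_closed_L \<open>fst ` T \<subseteq> L\<close>])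
  obtain u where u: "u \<in> U" "\<forall>x\<in>T. r\<inverse>\<inverse> (snd x) u"
    "\<forall>b\<in>L \<union> U. (\<forall>x\<in>T. r\<inverse>\<inverse> (snd x) b) \<longrightarrow> r\<inverse>\<inverse> u b"
    by (rule lub_closed_image_lub[OF lub_closed_U \<open>snd ` T \<subseteq> U\<close>])
  \<comment> \<open>This is where the chain condition enters: the pass from \<open>x\<close> to
    \<open>y\<close> goes through \<open>fst y\<close> or through \<open>snd x\<close>, depending on
    which of the two is larger.\<close>
  have cross: "r (fst x) (snd y)" if xy: "x \<in> T" "y \<in> T" for x y
  proof -
    note tr = transp_onD[OF order_on(3)]
    from chain xy consider "x \<sqsubseteq>\<^bsub>S\<^esub> y" | "y \<sqsubseteq>\<^bsub>S\<^esub> x" by blast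
    then show ?thesis
    proof cases
      case 1
      then show ?thesis
        using tr[of "fst x" "fst y" "snd y"] mem[OF xy(1)] mem[OF xy(2)]
        by (simp add: approximation_space_simps)
    next
      case 2
      then show ?thesis
        using tr[of "fst x" "snd x" "snd y"] mem[OF xy(1)] mem[OF xy(2)]
        by (simp add: approximation_space_simps)
    qed
  qed
  \<comment> \<open>\<open>snd y\<close> is an upper bound in \<open>U\<close> of elements of
    \<open>L\<close>, so this is ILP at work; the next step uses IGP in the same way with the lower
    bound \<open>s\<close>.\<close>
  have "r s (snd y)" if "y \<in> T" for y
    using s(3)[rule_format, of "snd y"] cross mem that by blast
  then have "r s u"
    using u(3)[rule_format, of s] s(1) by simp
  have "is_lub S (s, u) T"
    unfolding least_def
  proof (intro conjI ballI)
    show "(s, u) \<in> Upper S T"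
      using s(1,2) u(1,2) \<open>r s u\<close> by (fastforce simp: Upper_def approximation_space_simps)
    fix b assume "b \<in> Upper S T"
    then have "\<forall>x\<in>T. x \<sqsubseteq>\<^bsub>S\<^esub> b" "b \<in> carrier S"
      using T by (auto simp: Upper_def)
    then show "(s, u) \<sqsubseteq>\<^bsub>S\<^esub> b"
      using s(3)[rule_format, of "fst b"] u(3)[rule_format, of "snd b"]
      by (simp add: approximation_space_simps)
  qed simp
  then show "\<exists>s. is_lub S s T" ..
qed (rule partial_order_approximation_space)

end

text \<open>The middle two of four coordinates are exchanged; both orders consist of the same four
  comparisons.\<close>

lemma order_iso_approximation_space_times:
  "order_iso (approximation_space (L1 \<times> L2) (U1 \<times> U2) (prod_le r1 r2))
     (prod_poset (approximation_space L1 U1 r1) (approximation_space L2 U2 r2))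
     (\<lambda>(x, y). ((fst x, fst y), (snd x, snd y)))"
    (is "order_iso ?P ?Q ?\<phi>")
  unfolding order_iso_def
proof (intro conjI ballI)
  show "bij_betw ?\<phi> (carrier ?P) (carrier ?Q)"
    by (rule bij_betw_byWitness[where f' = "\<lambda>(p, q). ((fst p, fst q), (snd p, snd q))"])
      (auto simp: prod_poset_def prod_le_def approximation_space_simps)
  fix p q assume "p \<in> carrier ?P" "q \<in> carrier ?P"
  show "p \<sqsubseteq>\<^bsub>?P\<^esub> q \<longleftrightarrow> ?\<phi> p \<sqsubseteq>\<^bsub>?Q\<^esub> ?\<phi> q"
    by (cases p; cases q) (auto simp: prod_poset_def prod_le_def approximation_space_simps)
qed

text \<open>A monotone map into \<open>L \<otimes> U\<close> is a pair of a monotone map into \<open>L\<close> and an antitone map into \<open>U\<close>,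
  the former pointwise below the latter.\<close>

lemma order_iso_approximation_space_maps:
  fixes P :: "'a gorder"
  defines "X \<equiv> carrier P"
  shows "order_iso (approximation_space
      {f \<in> X \<rightarrow>\<^sub>E L. \<forall>a\<in>X. \<forall>b\<in>X. a \<sqsubseteq>\<^bsub>P\<^esub> b \<longrightarrow> r (f a) (f b)}
      {f \<in> X \<rightarrow>\<^sub>E U. \<forall>a\<in>X. \<forall>b\<in>X. a \<sqsubseteq>\<^bsub>P\<^esub> b \<longrightarrow> r (f b) (f a)} (fun_le X r))
     (map_poset P (approximation_space L U r)) (\<lambda>(f, g). \<lambda>a\<in>X. (f a, g a))"
    (is "order_iso ?P ?Q ?\<phi>")
  unfolding order_iso_def
proof (intro conjI ballI)
  show "bij_betw ?\<phi> (carrier ?P) (carrier ?Q)"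
  proof (rule bij_betw_byWitness[where f' = "\<lambda>h. (\<lambda>a\<in>X. fst (h a), \<lambda>a\<in>X. snd (h a))"])
    show "\<forall>p\<in>carrier ?P. (\<lambda>a\<in>X. fst (?\<phi> p a), \<lambda>a\<in>X. snd (?\<phi> p a)) = p"
      by (auto simp: approximation_space_simps fun_eq_iff PiE_iff extensional_def)
    show "\<forall>h\<in>carrier ?Q. ?\<phi> (\<lambda>a\<in>X. fst (h a), \<lambda>a\<in>X. snd (h a)) = h"
      by (auto simp: map_poset_def monotone_maps_def fun_eq_iff PiE_iff extensional_def X_def)
    show "?\<phi> ` carrier ?P \<subseteq> carrier ?Q"
      by (auto simp: map_poset_def approximation_space_simps fun_le_def PiE_iff X_def
          intro!: monotone_mapsI)
    show "(\<lambda>h. (\<lambda>a\<in>X. fst (h a), \<lambda>a\<in>X. snd (h a))) ` carrier ?Q \<subseteq> carrier ?P"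
      by (auto simp: map_poset_def monotone_maps_def approximation_space_simps fun_le_def PiE_iff
          X_def)
  qed
  fix p q assume "p \<in> carrier ?P" "q \<in> carrier ?P"
  show "p \<sqsubseteq>\<^bsub>?P\<^esub> q \<longleftrightarrow> ?\<phi> p \<sqsubseteq>\<^bsub>?Q\<^esub> ?\<phi> q"
    by (cases p; cases q) (auto simp: map_poset_def fun_le_def approximation_space_simps X_def)
qed

lemma order_iso_approximation_space_image:
  assumes gi: "\<And>x. x \<in> L \<union> U \<Longrightarrow> g (i x) = x"
  shows "order_iso (approximation_space (i ` L) (i ` U) (\<lambda>x y. r (g x) (g y)))
    (approximation_space L U r) (map_prod g g)"
    (is "order_iso ?P ?Q _")
  unfolding order_iso_def
proof (intro conjI ballI)
  show "bij_betw (map_prod g g) (carrier ?P) (carrier ?Q)"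
    using gi by (intro bij_betw_byWitness[where f' = "map_prod i i"])
      (auto simp: approximation_space_simps)
  fix p q
  show "p \<sqsubseteq>\<^bsub>?P\<^esub> q \<longleftrightarrow> map_prod g g p \<sqsubseteq>\<^bsub>?Q\<^esub> map_prod g g q"
    by (simp add: approximation_space_simps)
qed


section \<open>The category of approximation spaces\<close>

lemma fits_lepoll: "fits small B \<Longrightarrow> A \<lesssim> B \<Longrightarrow> fits small A"
  unfolding fits_def using lepoll_trans by blast

text \<open>Points of \<open>A\<close> go to the slice with second coordinate \<open>c\<close>. The
  other points keep themselves as second coordinate, which differs from \<open>c\<close> because
  \<open>c \<in> A\<close>. This bounds unions by means of closure under products.\<close>

lemma Un_lepoll_Times:
  assumes "c \<in> A \<inter> B"
  shows "A \<union> B \<lesssim> A \<times> B"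
proof -
  let ?f = "\<lambda>x. if x \<in> A then (x, c) else (c, x)"
  have "inj_on ?f (A \<union> B)" "?f ` (A \<union> B) \<subseteq> A \<times> B"
    using assms by (auto simp: inj_on_def split: if_splits)
  then show ?thesis
    unfolding lepoll_def by blast
qed

context smallness
begin

lemma fits_Times:
  assumes "fits small A" "fits small B"
  shows "fits small (A \<times> B)"
proof -
  obtain V W where "small V" "A \<lesssim> V" "small W" "B \<lesssim> W"
    using assms unfolding fits_def by blast
  then show ?thesis
    by (intro fits_lepoll[OF times_closed times_lepoll_mono])
qed

lemma fits_small_copy:
  assumes "fits small A"
  obtains i where "inj_on i A" "small (i ` A)"
proof -
  obtain V i where "small V" "inj_on i A" "i ` A \<subseteq> V"
    using assms unfolding fits_def lepoll_def by blast
  then have "small (i ` A)"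
    using lepoll_closed[OF _ subset_imp_lepoll, of V "i ` A"] by simp
  with \<open>inj_on i A\<close> show thesis by (rule that)
qed

definition spaces :: "('u \<times> 'u) gorder set" where
  "spaces = {approximation_space L U r | L U r. approximation_tuple L U r \<and> small (L \<union> U)}"

lemma spacesE:
  assumes "A \<in> spaces"
  obtains L U r where "A = approximation_space L U r" "approximation_tuple L U r" "small (L \<union> U)"
  using assms unfolding spaces_def by blast

sublocale poset_category spaces
  by (rule poset_category.intro)
    (auto elim!: spacesE intro: approximation_tuple.partial_order_approximation_space)

lemma approximation_category_eq: "approximation_category small = C"
  by (simp add: approximation_category_def spaces_def)

lemma fits_small: "small S \<Longrightarrow> fits small S"
  unfolding fits_def by blast

lemma fits_carrier:
  assumes "A \<in> spaces"
  shows "fits small (carrier A)"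
proof -
  obtain L U r where A: "A = approximation_space L U r" "small (L \<union> U)"
    using assms by (rule spacesE)
  then have "carrier A \<subseteq> (L \<union> U) \<times> (L \<union> U)"
    by (auto simp: approximation_space_simps)
  then show ?thesis
    using A(2) by (intro fits_lepoll[OF fits_Times[OF fits_small fits_small] subset_imp_lepoll])
qed

text \<open>Brings a tuple built over another type, such as pairs or functions, back among the
  objects over \<open>'u\<close>.\<close>

lemma ex_space_order_iso:
  assumes tuple: "approximation_tuple L U r" and fits: "fits small (L \<union> U)"
  obtains A \<phi> where "A \<in> spaces" "order_iso A (approximation_space L U r) \<phi>"
proof -
  obtain i where i: "inj_on i (L \<union> U)" "small (i ` (L \<union> U))"
    by (rule fits_small_copy[OF fits])
  let ?g = "inv_into (L \<union> U) i"
  have gi: "?g (i x) = x" if "x \<in> L \<union> U" for x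
    using i(1) that by simp
  show thesis
  proof (rule that)
    show "approximation_space (i ` L) (i ` U) (\<lambda>x y. r (?g x) (?g y)) \<in> spaces"
      using approximation_tuple_image[of L U r ?g i] tuple gi i(2)
      unfolding spaces_def image_Un by blast
    show "order_iso (approximation_space (i ` L) (i ` U) (\<lambda>x y. r (?g x) (?g y)))
        (approximation_space L U r) (map_prod ?g ?g)"
      by (rule order_iso_approximation_space_image) (rule gi)
  qed
qed

text \<open>Both categories are monotone categories with the same arrows, identities and
  composition, so the content is the inclusion of the objects.\<close>

lemma full_subcategory_cpo: "full_subcategory C (cpo_category small)"
proof -
  let ?K = "{P :: ('u \<times> 'u) gorder. chain_complete P \<and> fits small (carrier P)}"
  have "chain_complete A" if "A \<in> spaces" for A
    using that by (rule spacesE) (simp add: approximation_tuple.chain_complete_approximation_space)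
  then have "spaces \<subseteq> ?K"
    using fits_carrier by blast
  moreover have "poset_category ?K"
    by (rule poset_category.intro) (simp add: chain_complete_def)
  then have "category (monotone_category ?K)"
    by (rule poset_category.category)
  ultimately show ?thesis
    unfolding full_subcategory_def subcategory_def cpo_category_def
    by (intro conjI ballI category) (auto simp: monotone_category_def)
qed

lemma has_terminal: "has_terminal C"
proof -
  obtain S :: "'u set" and a where "small S" "a \<in> S"
    using nonempty by blast
  then have "small {a}"
    using lepoll_closed subset_imp_lepoll[of "{a}" S] by simp
  have "approximation_tuple {a} {a} (=)"
    by (rule approximation_tupleI)
      (auto simp: lub_closed_def intro: reflp_onI antisymp_onI transp_onI)
  then have "approximation_space {a} {a} (=) \<in> spaces"
    using \<open>small {a}\<close> unfolding spaces_def by fastforce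
  moreover have "carrier (approximation_space {a} {a} (=)) = {(a, a)}"
    by (auto simp: approximation_space_simps)
  ultimately show ?thesis
    unfolding has_terminal_def using is_terminalI by blast
qed

section \<open>Products and exponentials of approximation spaces\<close>

lemma ex_product_order_iso:
  assumes "A \<in> spaces" "B \<in> spaces"
  shows "\<exists>P\<in>spaces. \<exists>\<pi>. order_iso P (prod_poset A B) \<pi>"
proof -
  obtain L1 U1 r1 where A: "A = approximation_space L1 U1 r1"
    "approximation_tuple L1 U1 r1" "small (L1 \<union> U1)"
    using assms(1) by (rule spacesE)
  obtain L2 U2 r2 where B: "B = approximation_space L2 U2 r2"
    "approximation_tuple L2 U2 r2" "small (L2 \<union> U2)"
    using assms(2) by (rule spacesE)
  have "L1 \<times> L2 \<union> U1 \<times> U2 \<lesssim> (L1 \<union> U1) \<times> (L2 \<union> U2)"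
    by (rule subset_imp_lepoll) auto
  then have "fits small (L1 \<times> L2 \<union> U1 \<times> U2)"
    by (rule fits_lepoll[OF fits_Times[OF fits_small[OF A(3)] fits_small[OF B(3)]]])
  then obtain P \<phi> where "P \<in> spaces"
    "order_iso P (approximation_space (L1 \<times> L2) (U1 \<times> U2) (prod_le r1 r2)) \<phi>"
    by (rule ex_space_order_iso[OF approximation_tuple_times[OF A(2) B(2)]])
  then show ?thesis
    using order_iso_compose[OF _ order_iso_approximation_space_times] unfolding A(1) B(1) by blast
qed

lemma has_binary_products: "has_binary_products C"
  unfolding has_binary_products_def Ob_eq
  using ex_product_order_iso is_product_of_order_iso by metis

text \<open>The size hypothesis bounds the hom-set, whereas the exponential needs a bound on
  \<open>?L \<union> ?U\<close>. Each of \<open>?L\<close> and \<open>?U\<close> embeds into the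
  hom-set, and the union embeds into their product.\<close>

lemma has_exponential:
  assumes AB: "A \<in> spaces" "B \<in> spaces" and fits: "fits small (monotone_maps A B)"
  shows "has_exponential C A B"
proof -
  obtain L U r where B: "B = approximation_space L U r" and "approximation_tuple L U r"
    using AB(2) by (rule spacesE)
  interpret approximation_tuple L U r by fact
  let ?X = "carrier A"
  let ?L = "{f \<in> ?X \<rightarrow>\<^sub>E L. \<forall>a\<in>?X. \<forall>b\<in>?X. a \<sqsubseteq>\<^bsub>A\<^esub> b \<longrightarrow> r (f a) (f b)}"
  let ?U = "{f \<in> ?X \<rightarrow>\<^sub>E U. \<forall>a\<in>?X. \<forall>b\<in>?X. a \<sqsubseteq>\<^bsub>A\<^esub> b \<longrightarrow> r (f b) (f a)}"
  have tuple: "approximation_tuple ?L ?U (fun_le ?X r)"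
    by (rule approximation_tuple_funcset) fact
  obtain t where t: "t \<in> L \<inter> U" "\<forall>x\<in>L \<union> U. r x t" using top_elt by blast
  obtain b where b: "b \<in> L \<inter> U" "\<forall>x\<in>L \<union> U. r b x" using bottom_elt by blast
  \<comment> \<open>Pairing with the constant top makes a monotone map into \<open>L\<close> a map
    into \<open>L \<otimes> U\<close>; for \<open>?U\<close> below, the constant bottom does the
    same.\<close>
  have "?L \<lesssim> monotone_maps A B"
    unfolding lepoll_def
  proof (intro exI conjI)
    show "inj_on (\<lambda>f. \<lambda>a\<in>?X. (f a, t)) ?L"
    proof (rule inj_onI)
      fix f g assume "f \<in> ?L" "g \<in> ?L" and eq: "(\<lambda>a\<in>?X. (f a, t)) = (\<lambda>a\<in>?X. (g a, t))"
      then have "f \<in> ?X \<rightarrow>\<^sub>E L" "g \<in> ?X \<rightarrow>\<^sub>E L" by simp_all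
      then show "f = g"
      proof (rule PiE_ext)
        fix a assume "a \<in> ?X"
        then show "f a = g a"
          using fun_cong[OF eq, of a] by simp
      qed
    qed
    show "(\<lambda>f. \<lambda>a\<in>?X. (f a, t)) ` ?L \<subseteq> monotone_maps A B"
      using t by (auto simp: B approximation_space_simps PiE_iff intro!: monotone_mapsI)
  qed
  moreover have "?U \<lesssim> monotone_maps A B"
    unfolding lepoll_def
  proof (intro exI conjI)
    show "inj_on (\<lambda>f. \<lambda>a\<in>?X. (b, f a)) ?U"
    proof (rule inj_onI)
      fix f g assume "f \<in> ?U" "g \<in> ?U" and eq: "(\<lambda>a\<in>?X. (b, f a)) = (\<lambda>a\<in>?X. (b, g a))"
      then have "f \<in> ?X \<rightarrow>\<^sub>E U" "g \<in> ?X \<rightarrow>\<^sub>E U" by simp_all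
      then show "f = g"
      proof (rule PiE_ext)
        fix a assume "a \<in> ?X"
        then show "f a = g a"
          using fun_cong[OF eq, of a] by simp
      qed
    qed
    show "(\<lambda>f. \<lambda>a\<in>?X. (b, f a)) ` ?U \<subseteq> monotone_maps A B"
      using b by (auto simp: B approximation_space_simps PiE_iff intro!: monotone_mapsI)
  qed
  \<comment> \<open>The common element required by \<open>Un_lepoll_Times\<close>.\<close>
  moreover obtain c where "c \<in> ?L \<inter> ?U"
    using approximation_tuple.top_elt[OF tuple] by blast
  ultimately have "fits small (?L \<union> ?U)"
    by (intro fits_lepoll[OF fits_Times Un_lepoll_Times] fits_lepoll[OF fits])
  then obtain E \<phi> where "E \<in> spaces" "order_iso E (approximation_space ?L ?U (fun_le ?X r)) \<phi>"
    by (rule ex_space_order_iso[OF tuple])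
  then show ?thesis
    using order_iso_compose[OF _ order_iso_approximation_space_maps, of E A L r U \<phi>] AB
    by (intro has_exponential_of_order_iso[OF ex_product_order_iso]) (simp_all add: B)
qed

end

lemma (in universe) fits_monotone_maps:
  assumes "A \<in> spaces" "B \<in> spaces"
  shows "fits small (monotone_maps A B)"
proof -
  obtain V W where V: "small V" "carrier A \<lesssim> V" and W: "small W" "carrier B \<lesssim> W"
    using assms fits_carrier unfolding fits_def by blast
  obtain L U r where B: "B = approximation_space L U r" and "approximation_tuple L U r"
    using assms(2) by (rule spacesE)
  interpret approximation_tuple L U r by fact
  \<comment> \<open>\<open>carrier B\<close> must be nonempty: maps on \<open>carrier A\<close> have
    to be extended over the rest of \<open>V\<close> by some value.\<close>
  obtain t where "t \<in> L \<inter> U" "r t t"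
    using top_elt by blast
  then have "(t, t) \<in> carrier B"
    by (simp add: B approximation_space_simps)
  then have "carrier A \<rightarrow>\<^sub>E carrier B \<lesssim> V \<rightarrow>\<^sub>E W"
    using V(2) W(2) by (intro lepoll_funcset) auto
  moreover have "monotone_maps A B \<lesssim> carrier A \<rightarrow>\<^sub>E carrier B"
    by (rule subset_imp_lepoll) (auto simp: monotone_maps_def)
  ultimately show ?thesis
    by (intro fits_lepoll[OF fits_lepoll[OF funcset_closed[OF V(1) W(1)]]])
qed

theorem theorem1:
  fixes small :: "'u set \<Rightarrow> bool"
  assumes "smallness small"
  shows "full_subcategory (approximation_category small) (cpo_category small) \<and>
    has_terminal (approximation_category small) \<and>
    has_binary_products (approximation_category small) \<and>
    (\<forall>A\<in>Ob (approximation_category small). \<forall>B\<in>Ob (approximation_category small).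
       fits small (Hom (approximation_category small) A B) \<longrightarrow>
       has_exponential (approximation_category small) A B) \<and>
    (universe small \<longrightarrow> cartesian_closed (approximation_category small))"
proof -
  interpret smallness small by fact
  \<comment> \<open>In a universe every hom-set fits, so the size condition on exponentials is
    always met.\<close>
  have "cartesian_closed C" if "universe small"
    unfolding cartesian_closed_def Ob_eq
    by (intro conjI ballI category has_terminal has_binary_products has_exponential
        universe.fits_monotone_maps[OF that])
  then show ?thesis
    unfolding approximation_category_eq Ob_eq
    by (intro conjI ballI impI full_subcategory_cpo has_terminal has_binary_products has_exponential)
      (simp_all add: Hom_eq)
qed

end
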